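(* Let $\mathcal O$ be a Krom-LTL ontology and let $A$ be an atomic concept. Then the ontology-mediated atomic query $\boldsymbol q=(\mathcal O,A)$ is $\mathrm{FO}(<,\equiv)$-rewritable. That is, there is a constant-free $\mathrm{FO}(<,\equiv)$-formula $\boldsymbol Q(t)$ with a single free variable $t$ such that, for every data instance $\mathcal A$, $\mathrm{ans}(\boldsymbol q,\mathcal A)=\{\ell\in\mathrm{tem}(\mathcal A)\mid \mathfrak S_{\mathcal A}\models\boldsymbol Q(\ell)\}$.
   Context: Fix a countably infinite set of atomic concepts $A_i$, $i<\omega$. A (temporal) interpretation $\mathfrak M$ assigns to every atomic concept $A$ a set $A^{\mathfrak M}\subseteq\mathbb Z$. The unary temporal operators are interpreted (strictly) by $(\bigcirc_F\varkappa)^{\mathfrak M}=\{n\mid n+1\in\varkappa^{\mathfrak M}\}$, $(\bigcirc_P\varkappa)^{\mathfrak M}=\{n\mid n-1\in\varkappa^{\mathfrak M}\}$, $(\Box_F\varkappa)^{\mathfrak M}=\{n\mid k\in\varkappa^{\mathfrak M}\text{ for all }k>n\}$, $(\Diamond_F\varkappa)^{\mathfrak M}=\{n\mid k\in\varkappa^{\mathfrak M}\text{ for some }k>n\}$, and symmetrically for $\Box_P,\Diamond_P$ with $k<n$; Boolean connectives are interpreted set-theoretically (negation is complement in $\mathbb Z$). Krom-LTL is the set of all formulas constructed using arbitrary Boolean operators from at most two formulas, each of which is an atomic concept prefixed with an arbitrary (possibly empty) sequence of unary operators from $\Box_P,\bigcirc_P,\Diamond_P,\Box_F,\bigcirc_F,\Diamond_F$.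 A Krom-LTL ontology $\mathcal O$ is a finite set of Krom-LTL formulas (axioms), interpreted globally: $\mathfrak M$ is a model of $\mathcal O$ if $\alpha^{\mathfrak M}=\mathbb Z$ for all $\alpha\in\mathcal O$. A data instance $\mathcal A$ is a finite set of ground atoms $A_i(\ell)$ with $\ell\in\mathbb Z$; $\min\mathcal A$ and $\max\mathcal A$ are the least and greatest integers occurring in it, and it is assumed throughout that $\min\mathcal A=0$ and $\max\mathcal A\ge 1$. Its active domain is $\mathrm{tem}(\mathcal A)=\{n\in\mathbb Z\mid\min\mathcal A\le n\le\max\mathcal A\}$. $\mathfrak M$ is a model of $(\mathcal O,\mathcal A)$ if it is a model of $\mathcal O$ and $\ell\in B^{\mathfrak M}$ for all $B(\ell)\in\mathcal A$. The set of certain answers is $\mathrm{ans}(\boldsymbol q,\mathcal A)=\{\ell\in\mathrm{tem}(\mathcal A)\mid \ell\in A^{\mathfrak M}\text{ for every model }\mathfrak M\text{ of }(\mathcal O,\mathcal A)\}$. $\mathfrak S_{\mathcal A}$ is the finite first-order structure with domain $\mathrm{tem}(\mathcal A)$ ordered by $<$, in which $\mathfrak S_{\mathcal A}\models B(\ell)$ iff $B(\ell)\in\mathcal A$, for every atomic concept $B$ (viewed as a unary predicate). $\mathrm{FO}(<,\equiv)$ is first-order logic over the unary predicates $A_i$, the binary predicate $<$, and the unary numeric predicates $t\equiv 0\pmod n$, for each fixed $n>1$, where $\mathfrak S_{\mathcal A}\models \ell\equiv 0\pmod n$ iff $n$ divides $\ell$. *)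

theory Defs
  imports Main
begin

text \<open>The atomic concept $A_i$ is represented by its index $i$.\<close>

type_synonym concept = nat

datatype tempop = Box_P | Next_P | Dia_P | Box_F | Next_F | Dia_F

text \<open>
  A Boolean operator is given by its truth function. In \<open>BoolOp f \<phi>s\<close> only the values of \<open>f\<close>
  on lists of length \<open>length \<phi>s\<close> matter, so that operators of every arity are available,
  including the two constants (arity zero).
\<close>

datatype ltl =
    Atom concept
  | Temp tempop ltl
  | BoolOp "bool list \<Rightarrow> bool" "ltl list"

type_synonym interp = "concept \<Rightarrow> int set"

fun tempop_sem :: "tempop \<Rightarrow> int set \<Rightarrow> int set" where
  "tempop_sem Next_F X = {n. n + 1 \<in> X}"
| "tempop_sem Next_P X = {n. n - 1 \<in> X}"
| "tempop_sem Box_F X = {n. \<forall>k>n. k \<in> X}"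
| "tempop_sem Box_P X = {n. \<forall>k<n. k \<in> X}"
| "tempop_sem Dia_F X = {n. \<exists>k>n. k \<in> X}"
| "tempop_sem Dia_P X = {n. \<exists>k<n. k \<in> X}"

primrec ltl_sem :: "interp \<Rightarrow> ltl \<Rightarrow> int set" where
  "ltl_sem M (Atom A) = M A"
| "ltl_sem M (Temp u \<phi>) = tempop_sem u (ltl_sem M \<phi>)"
| "ltl_sem M (BoolOp f \<phi>s) = {n. f (map (\<lambda>X. n \<in> X) (map (ltl_sem M) \<phi>s))}"

inductive prefixed_atom :: "ltl \<Rightarrow> bool" where
  "prefixed_atom (Atom A)"
| "prefixed_atom \<phi> \<Longrightarrow> prefixed_atom (Temp u \<phi>)"

inductive bool_comb :: "ltl set \<Rightarrow> ltl \<Rightarrow> bool" for L where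
  base: "\<phi> \<in> L \<Longrightarrow> bool_comb L \<phi>"
| oper: "(\<And>\<phi>. \<phi> \<in> set \<phi>s \<Longrightarrow> bool_comb L \<phi>) \<Longrightarrow> bool_comb L (BoolOp f \<phi>s)"

text \<open>Each of the at most two prefixed atoms may occur several times in the formula.\<close>

definition krom_formula :: "ltl \<Rightarrow> bool" where
  "krom_formula \<phi> \<longleftrightarrow>
     (\<exists>L. finite L \<and> card L \<le> 2 \<and> (\<forall>\<chi>\<in>L. prefixed_atom \<chi>) \<and> bool_comb L \<phi>)"

definition krom_ontology :: "ltl set \<Rightarrow> bool" where
  "krom_ontology \<O> \<longleftrightarrow> finite \<O> \<and> (\<forall>\<alpha>\<in>\<O>. krom_formula \<alpha>)"

definition ontology_model :: "interp \<Rightarrow> ltl set \<Rightarrow> bool" where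
  "ontology_model M \<O> \<longleftrightarrow> (\<forall>\<alpha>\<in>\<O>. ltl_sem M \<alpha> = UNIV)"

text \<open>The pair \<open>(B, l)\<close> stands for the ground atom $B(l)$.\<close>

type_synonym data = "(concept \<times> int) set"

definition min_time :: "data \<Rightarrow> int" where
  "min_time \<A> = Min (snd ` \<A>)"

definition max_time :: "data \<Rightarrow> int" where
  "max_time \<A> = Max (snd ` \<A>)"

definition data_instance :: "data \<Rightarrow> bool" where
  "data_instance \<A> \<longleftrightarrow> finite \<A> \<and> \<A> \<noteq> {} \<and> min_time \<A> = 0 \<and> max_time \<A> \<ge> 1"

definition tem :: "data \<Rightarrow> int set" where
  "tem \<A> = {min_time \<A>..max_time \<A>}"

definition kb_model :: "interp \<Rightarrow> ltl set \<Rightarrow> data \<Rightarrow> bool" where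
  "kb_model M \<O> \<A> \<longleftrightarrow> ontology_model M \<O> \<and> (\<forall>(B, l)\<in>\<A>. l \<in> M B)"

type_synonym atomic_query = "ltl set \<times> concept"

definition ans :: "atomic_query \<Rightarrow> data \<Rightarrow> int set" where
  "ans q \<A> = {l \<in> tem \<A>. \<forall>M. kb_model M (fst q) \<A> \<longrightarrow> l \<in> M (snd q)}"

text \<open>
  Variables are natural numbers; the syntax has no constants. \<open>FCong n x\<close> is the numeric
  predicate $x \equiv 0 \pmod n$, which belongs to the language only for $n > 1$.
\<close>

datatype fo =
    FPred concept nat
  | FLess nat nat
  | FEq nat nat
  | FCong nat nat
  | FNeg fo
  | FConj fo fo
  | FDisj fo fo
  | FEx nat fo
  | FAll nat fo

primrec fo_lt_cong :: "fo \<Rightarrow> bool" where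
  "fo_lt_cong (FPred B x) = True"
| "fo_lt_cong (FLess x y) = True"
| "fo_lt_cong (FEq x y) = True"
| "fo_lt_cong (FCong n x) = (n > 1)"
| "fo_lt_cong (FNeg \<phi>) = fo_lt_cong \<phi>"
| "fo_lt_cong (FConj \<phi> \<psi>) = (fo_lt_cong \<phi> \<and> fo_lt_cong \<psi>)"
| "fo_lt_cong (FDisj \<phi> \<psi>) = (fo_lt_cong \<phi> \<and> fo_lt_cong \<psi>)"
| "fo_lt_cong (FEx x \<phi>) = fo_lt_cong \<phi>"
| "fo_lt_cong (FAll x \<phi>) = fo_lt_cong \<phi>"

primrec fo_free :: "fo \<Rightarrow> nat set" where
  "fo_free (FPred B x) = {x}"
| "fo_free (FLess x y) = {x, y}"
| "fo_free (FEq x y) = {x, y}"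
| "fo_free (FCong n x) = {x}"
| "fo_free (FNeg \<phi>) = fo_free \<phi>"
| "fo_free (FConj \<phi> \<psi>) = fo_free \<phi> \<union> fo_free \<psi>"
| "fo_free (FDisj \<phi> \<psi>) = fo_free \<phi> \<union> fo_free \<psi>"
| "fo_free (FEx x \<phi>) = fo_free \<phi> - {x}"
| "fo_free (FAll x \<phi>) = fo_free \<phi> - {x}"

text \<open>Satisfaction in the structure $\mathfrak{S}_{\mathcal A}$, with domain \<open>tem \<A>\<close>.\<close>

primrec fo_sat :: "data \<Rightarrow> (nat \<Rightarrow> int) \<Rightarrow> fo \<Rightarrow> bool" where
  "fo_sat \<A> \<sigma> (FPred B x) = ((B, \<sigma> x) \<in> \<A>)"
| "fo_sat \<A> \<sigma> (FLess x y) = (\<sigma> x < \<sigma> y)"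
| "fo_sat \<A> \<sigma> (FEq x y) = (\<sigma> x = \<sigma> y)"
| "fo_sat \<A> \<sigma> (FCong n x) = (int n dvd \<sigma> x)"
| "fo_sat \<A> \<sigma> (FNeg \<phi>) = (\<not> fo_sat \<A> \<sigma> \<phi>)"
| "fo_sat \<A> \<sigma> (FConj \<phi> \<psi>) = (fo_sat \<A> \<sigma> \<phi> \<and> fo_sat \<A> \<sigma> \<psi>)"
| "fo_sat \<A> \<sigma> (FDisj \<phi> \<psi>) = (fo_sat \<A> \<sigma> \<phi> \<or> fo_sat \<A> \<sigma> \<psi>)"
| "fo_sat \<A> \<sigma> (FEx x \<phi>) = (\<exists>d\<in>tem \<A>. fo_sat \<A> (\<sigma>(x := d)) \<phi>)"
| "fo_sat \<A> \<sigma> (FAll x \<phi>) = (\<forall>d\<in>tem \<A>. fo_sat \<A> (\<sigma>(x := d)) \<phi>)"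

text \<open>
  As \<open>t\<close> is the only free variable of \<open>Q\<close>, the constant assignment \<open>\<lambda>_. l\<close>
  evaluates $Q(l)$.
\<close>

definition fo_lt_cong_rewritable :: "atomic_query \<Rightarrow> bool" where
  "fo_lt_cong_rewritable q \<longleftrightarrow>
     (\<exists>Q t. fo_lt_cong Q \<and> fo_free Q = {t} \<and>
        (\<forall>\<A>. data_instance \<A> \<longrightarrow> ans q \<A> = {l \<in> tem \<A>. fo_sat \<A> (\<lambda>_. l) Q}))"

end

theory Submission imports Defs
begin

text \<open>
  A model induces a run of types, the sets of prefixed atoms true at each instant. Box and diamond
  formulas are monotone in time, so along a run their values change a bounded number of times. While
  they are constant, the remaining conditions are binary clauses, hence the runs between two given
  types are closed under pointwise majority; by the resulting Helly property, finitely many literals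
  can be satisfied together as soon as any two of them can. For two literals this is a question about
  powers of a finite relation, which are ultimately periodic in the exponent and therefore
  \<open>FO(<,\<equiv>)\<close>-definable. A first-order formula can quantify over the change points, and
  guess the types next to them and at the two ends of the data. Beyond these ends the run is
  continued by copying models of the ontology.
\<close>

section \<open>Definable predicates\<close>

text \<open>The obstacle is the law of a box: \<open>Temp Box_F \<chi>\<close> holds now iff both it
  and \<open>\<chi>\<close> hold at the next instant. This relates three literals, and majority
  breaks it: 001, 010 and 111 satisfy "x iff y and z", their majority 011 does not. Once the truth
  value of the box is frozen, only a condition on \<open>\<chi>\<close> alone is left, and majority
  respects it. Freezing is affordable because each box or diamond formula can change its value only
  once along a run, in a direction fixed by its operator. Data put an unbounded number of literals
  on a stretch between two changes, and a finite relation with such side conditions can in general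
  describe any regular language. The Helly property removes this: two quantified instants suffice.
  Congruences enter only through the periods of powers. The one-step laws do not exclude a diamond
  that is promised forever and never fulfilled. For this reason the types at the two ends of the
  data are taken from actual models. The set of these types does not depend on the data, so it may
  be fixed without being computed.\<close>

text \<open>Closure properties of this semantic notion replace explicit formulas. All variables,
  also those outside \<open>X\<close>, take values in the active domain, so rebinding a variable to
  a domain element preserves the condition on \<open>\<sigma>\<close>.\<close>

definition definable :: "nat set \<Rightarrow> (data \<Rightarrow> (nat \<Rightarrow> int) \<Rightarrow> bool) \<Rightarrow> bool" where
  "definable X P \<longleftrightarrow> (\<exists>\<phi>. fo_lt_cong \<phi> \<and> fo_free \<phi> \<subseteq> X \<and>
     (\<forall>\<A> \<sigma>. data_instance \<A> \<longrightarrow> range \<sigma> \<subseteq> tem \<A> \<longrightarrow> (fo_sat \<A> \<sigma> \<phi> \<longleftrightarrow> P \<A> \<sigma>)))"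

lemma definable_cong:
  assumes "definable X P"
    and "\<And>\<A> \<sigma>. data_instance \<A> \<Longrightarrow> range \<sigma> \<subseteq> tem \<A> \<Longrightarrow> P \<A> \<sigma> \<longleftrightarrow> P' \<A> \<sigma>"
  shows "definable X P'"
  using assms unfolding definable_def by blast

lemma definable_less: "x \<in> X \<Longrightarrow> y \<in> X \<Longrightarrow> definable X (\<lambda>\<A> \<sigma>. \<sigma> x < \<sigma> y)"
  unfolding definable_def by (rule exI[of _ "FLess x y"]) simp

lemma definable_eq: "x \<in> X \<Longrightarrow> y \<in> X \<Longrightarrow> definable X (\<lambda>\<A> \<sigma>. \<sigma> x = \<sigma> y)"
  unfolding definable_def by (rule exI[of _ "FEq x y"]) simp

lemma definable_pred: "x \<in> X \<Longrightarrow> definable X (\<lambda>\<A> \<sigma>. (B, \<sigma> x) \<in> \<A>)"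
  unfolding definable_def by (rule exI[of _ "FPred B x"]) simp

lemma definable_dvd: "x \<in> X \<Longrightarrow> n > 1 \<Longrightarrow> definable X (\<lambda>\<A> \<sigma>. int n dvd \<sigma> x)"
  unfolding definable_def by (rule exI[of _ "FCong n x"]) simp

lemma definable_not: "definable X P \<Longrightarrow> definable X (\<lambda>\<A> \<sigma>. \<not> P \<A> \<sigma>)"
  unfolding definable_def by (metis fo_free.simps(5) fo_lt_cong.simps(5) fo_sat.simps(5))

lemma definable_conj:
  assumes "definable X P" "definable X P'"
  shows "definable X (\<lambda>\<A> \<sigma>. P \<A> \<sigma> \<and> P' \<A> \<sigma>)"
proof -
  obtain \<phi> \<psi> where
    "fo_lt_cong \<phi>" "fo_free \<phi> \<subseteq> X" "fo_lt_cong \<psi>" "fo_free \<psi> \<subseteq> X"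
    "\<And>\<A> \<sigma>. data_instance \<A> \<Longrightarrow> range \<sigma> \<subseteq> tem \<A> \<Longrightarrow> fo_sat \<A> \<sigma> \<phi> \<longleftrightarrow> P \<A> \<sigma>"
    "\<And>\<A> \<sigma>. data_instance \<A> \<Longrightarrow> range \<sigma> \<subseteq> tem \<A> \<Longrightarrow> fo_sat \<A> \<sigma> \<psi> \<longleftrightarrow> P' \<A> \<sigma>"
    using assms unfolding definable_def by blast
  then show ?thesis
    unfolding definable_def by (intro exI[of _ "FConj \<phi> \<psi>"]) simp
qed

lemma definable_disj:
  "definable X P \<Longrightarrow> definable X P' \<Longrightarrow> definable X (\<lambda>\<A> \<sigma>. P \<A> \<sigma> \<or> P' \<A> \<sigma>)"
  by (rule definable_cong[OF definable_not[OF definable_conj[OF definable_not definable_not]]]) auto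

lemma definable_imp:
  "definable X P \<Longrightarrow> definable X P' \<Longrightarrow> definable X (\<lambda>\<A> \<sigma>. P \<A> \<sigma> \<longrightarrow> P' \<A> \<sigma>)"
  by (rule definable_cong[OF definable_disj[OF definable_not]]) auto

lemma definable_const: "definable X (\<lambda>\<A> \<sigma>. c)"
proof -
  \<comment> \<open>A sentence is used because \<open>X\<close> may be empty.\<close>
  have tr: "definable X (\<lambda>\<A> \<sigma>. True)"
    unfolding definable_def
    by (rule exI[of _ "FAll 0 (FEq 0 0)"]) simp
  show ?thesis
    using tr definable_not[OF tr] by (cases c) simp_all
qed

lemma definable_le: "x \<in> X \<Longrightarrow> y \<in> X \<Longrightarrow> definable X (\<lambda>\<A> \<sigma>. \<sigma> x \<le> \<sigma> y)"
  by (rule definable_cong[OF definable_not[OF definable_less[of y X x]]]) auto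

lemma definable_bex_finite:
  assumes "finite I" "\<And>i. i \<in> I \<Longrightarrow> definable X (P i)"
  shows "definable X (\<lambda>\<A> \<sigma>. \<exists>i\<in>I. P i \<A> \<sigma>)"
  using assms by (induction I) (auto intro: definable_const definable_disj)

lemma definable_ball_finite:
  assumes "finite I" "\<And>i. i \<in> I \<Longrightarrow> definable X (P i)"
  shows "definable X (\<lambda>\<A> \<sigma>. \<forall>i\<in>I. P i \<A> \<sigma>)"
  using assms by (induction I) (auto intro: definable_const definable_conj)

text \<open>The bound variable is some \<open>z\<close> outside the finite set \<open>X\<close>.
  Binding overwrites \<open>\<sigma> z\<close>, so \<open>P\<close> receives the element as a
  separate argument and \<open>indep\<close> rules out any other dependence on that value.\<close>

lemma definable_ex:
  assumes "finite X"
    and P: "\<And>z. z \<notin> X \<Longrightarrow> definable (insert z X) (\<lambda>\<A> \<sigma>. P \<A> \<sigma> (\<sigma> z))"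
    and indep: "\<And>\<A> \<sigma> z d. z \<notin> X \<Longrightarrow> P \<A> (\<sigma>(z := d)) d \<longleftrightarrow> P \<A> \<sigma> d"
  shows "definable X (\<lambda>\<A> \<sigma>. \<exists>d\<in>tem \<A>. P \<A> \<sigma> d)"
proof -
  obtain z where z: "z \<notin> X"
    using ex_new_if_finite[OF infinite_UNIV_nat \<open>finite X\<close>] by blast
  obtain \<phi> where \<phi>: "fo_lt_cong \<phi>" "fo_free \<phi> \<subseteq> insert z X"
    "\<And>\<A> \<sigma>. data_instance \<A> \<Longrightarrow> range \<sigma> \<subseteq> tem \<A> \<Longrightarrow> fo_sat \<A> \<sigma> \<phi> \<longleftrightarrow> P \<A> \<sigma> (\<sigma> z)"
    using P[OF z] unfolding definable_def by blast
  have "fo_sat \<A> \<sigma> (FEx z \<phi>) \<longleftrightarrow> (\<exists>d\<in>tem \<A>. P \<A> \<sigma> d)"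
    if "data_instance \<A>" "range \<sigma> \<subseteq> tem \<A>" for \<A> \<sigma>
  proof -
    have "range (\<sigma>(z := d)) \<subseteq> tem \<A>" if "d \<in> tem \<A>" for d
      using that \<open>range \<sigma> \<subseteq> tem \<A>\<close> by auto
    then show ?thesis
      using \<phi>(3)[OF that(1)] indep[OF z] by simp
  qed
  then show ?thesis
    using \<phi>(1,2) unfolding definable_def by (intro exI[of _ "FEx z \<phi>"]) auto
qed

lemma definable_all:
  assumes "finite X"
    and "\<And>z. z \<notin> X \<Longrightarrow> definable (insert z X) (\<lambda>\<A> \<sigma>. P \<A> \<sigma> (\<sigma> z))"
    and "\<And>\<A> \<sigma> z d. z \<notin> X \<Longrightarrow> P \<A> (\<sigma>(z := d)) d \<longleftrightarrow> P \<A> \<sigma> d"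
  shows "definable X (\<lambda>\<A> \<sigma>. \<forall>d\<in>tem \<A>. P \<A> \<sigma> d)"
proof (rule definable_cong[OF definable_not[OF definable_ex[where P = "\<lambda>\<A> \<sigma> d. \<not> P \<A> \<sigma> d"]]])
  show "definable (insert z X) (\<lambda>\<A> \<sigma>. \<not> P \<A> \<sigma> (\<sigma> z))" if "z \<notin> X" for z
    using assms(2)[OF that] by (rule definable_not)
qed (use assms in auto)

section \<open>Distances and residues in the active domain\<close>

lemma tem_interval: "a \<in> tem \<A> \<Longrightarrow> b \<in> tem \<A> \<Longrightarrow> a \<le> c \<Longrightarrow> c \<le> b \<Longrightarrow> c \<in> tem \<A>"
  by (auto simp: tem_def)

lemma tem_data_instance: "data_instance \<A> \<Longrightarrow> tem \<A> = {0..max_time \<A>} \<and> 0 < max_time \<A>"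
  by (auto simp: tem_def data_instance_def)

text \<open>The language has no successor: each unit step is expressed by an empty open interval.
  The intermediate points lie between \<open>\<sigma> x\<close> and \<open>\<sigma> y\<close>, hence
  in the domain.\<close>

lemma definable_add:
  assumes "finite X" "x \<in> X" "y \<in> X"
  shows "definable X (\<lambda>\<A> \<sigma>. \<sigma> y = \<sigma> x + int c)"
  using assms
proof (induction c arbitrary: X y)
  case 0
  then show ?case
    using definable_eq[of y X x] by simp
next
  case (Suc c)
  have d: "definable X (\<lambda>\<A> \<sigma>. \<exists>z\<in>tem \<A>. z = \<sigma> x + int c \<and> z < \<sigma> y \<and>
            (\<forall>w\<in>tem \<A>. \<not> (z < w \<and> w < \<sigma> y)))"
  proof (rule definable_ex[OF Suc.prems(1)])
    fix z assume z: "z \<notin> X"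
    show "definable (insert z X) (\<lambda>\<A> \<sigma>. \<sigma> z = \<sigma> x + int c \<and> \<sigma> z < \<sigma> y \<and>
            (\<forall>w\<in>tem \<A>. \<not> (\<sigma> z < w \<and> w < \<sigma> y)))"
      using Suc z
      by (intro definable_conj definable_less definable_all definable_not) auto
  qed (use Suc in auto)
  show ?case
  proof (rule definable_cong[OF d])
    fix \<A> :: data and \<sigma> :: "nat \<Rightarrow> int"
    assume "data_instance \<A>" and \<sigma>: "range \<sigma> \<subseteq> tem \<A>"
    have t: "\<sigma> x \<in> tem \<A>" "\<sigma> y \<in> tem \<A>" using \<sigma> by auto
    have *: "w \<in> tem \<A>" if "\<sigma> x \<le> w" "w \<le> \<sigma> y" for w
      using tem_interval[OF t that] .
    show "(\<exists>z\<in>tem \<A>. z = \<sigma> x + int c \<and> z < \<sigma> y \<and> (\<forall>w\<in>tem \<A>. \<not> (z < w \<and> w < \<sigma> y)))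
       \<longleftrightarrow> \<sigma> y = \<sigma> x + int (Suc c)"
    proof
      assume "\<exists>z\<in>tem \<A>. z = \<sigma> x + int c \<and> z < \<sigma> y \<and> (\<forall>w\<in>tem \<A>. \<not> (z < w \<and> w < \<sigma> y))"
      then have "\<sigma> x + int c < \<sigma> y"
        and "\<sigma> x + int c + 1 \<in> tem \<A> \<Longrightarrow> \<not> (\<sigma> x + int c + 1 < \<sigma> y)"
        by auto
      then show "\<sigma> y = \<sigma> x + int (Suc c)"
        using *[of "\<sigma> x + int c + 1"] by auto
    next
      assume "\<sigma> y = \<sigma> x + int (Suc c)"
      then show "\<exists>z\<in>tem \<A>. z = \<sigma> x + int c \<and> z < \<sigma> y \<and> (\<forall>w\<in>tem \<A>. \<not> (z < w \<and> w < \<sigma> y))"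
        using *[of "\<sigma> x + int c"] by auto
    qed
  qed
qed

text \<open>Only divisibility is atomic, so the residue is found as the distance to a multiple of
  \<open>p\<close> below. That multiple belongs to the domain because the domain starts at
  0.\<close>

lemma definable_mod:
  assumes "finite X" "x \<in> X" "1 < p" "a < p"
  shows "definable X (\<lambda>\<A> \<sigma>. \<sigma> x mod int p = int a)"
proof (rule definable_cong)
  show "definable X (\<lambda>\<A> \<sigma>. \<exists>z\<in>tem \<A>. int p dvd z \<and> \<sigma> x = z + int a)"
    using assms by (intro definable_ex definable_conj definable_dvd definable_add) auto
next
  fix \<A> :: data and \<sigma> :: "nat \<Rightarrow> int"
  assume "data_instance \<A>" and \<sigma>: "range \<sigma> \<subseteq> tem \<A>"
  then have "\<sigma> x \<in> tem \<A>" by auto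
  then have x: "\<sigma> x \<in> {0..max_time \<A>}"
    using tem_data_instance[OF \<open>data_instance \<A>\<close>] by simp
  have "\<sigma> x - \<sigma> x mod int p \<in> tem \<A>"
  proof -
    have "0 \<le> \<sigma> x mod int p" using assms(3) by simp
    moreover have "\<sigma> x mod int p \<le> \<sigma> x" using x by (simp add: zmod_le_nonneg_dividend)
    ultimately show ?thesis
      using x tem_data_instance[OF \<open>data_instance \<A>\<close>] unfolding atLeastAtMost_iff
      by (metis atLeastAtMost_iff diff_ge_0_iff_ge diff_left_mono diff_zero order.trans)
  qed
  moreover have "int p dvd \<sigma> x - \<sigma> x mod int p"
    by (rule dvd_minus_mod)
  ultimately show "(\<exists>z\<in>tem \<A>. int p dvd z \<and> \<sigma> x = z + int a) \<longleftrightarrow> \<sigma> x mod int p = int a"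
  proof (intro iffI)
    assume "\<exists>z\<in>tem \<A>. int p dvd z \<and> \<sigma> x = z + int a"
    then obtain k where "\<sigma> x = int p * k + int a" by (auto elim: dvdE)
    then show "\<sigma> x mod int p = int a" using assms(4) by simp
  next
    assume "\<sigma> x mod int p = int a"
    with \<open>\<sigma> x - \<sigma> x mod int p \<in> tem \<A>\<close> \<open>int p dvd \<sigma> x - \<sigma> x mod int p\<close>
    show "\<exists>z\<in>tem \<A>. int p dvd z \<and> \<sigma> x = z + int a"
      by (intro bexI[of _ "\<sigma> x - \<sigma> x mod int p"]) simp_all
  qed
qed

lemma ult_periodic_cong:
  fixes N p :: nat
  assumes per: "\<And>d. d \<ge> N \<Longrightarrow> d + p \<in> D \<longleftrightarrow> d \<in> D"
    and "d \<ge> N" "d' \<ge> N" "int d mod int p = int d' mod int p"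
  shows "d \<in> D \<longleftrightarrow> d' \<in> D"
proof -
  have mult: "e + k * p \<in> D \<longleftrightarrow> e \<in> D" if "e \<ge> N" for e k
  proof (induction k)
    case (Suc k)
    then show ?case using per[of "e + k * p"] that by (simp add: ac_simps)
  qed simp
  have le: "a \<in> D \<longleftrightarrow> b \<in> D" if ab: "a \<ge> N" "a \<le> b" "a mod p = b mod p" for a b
  proof -
    obtain k where "b = a + k * p"
      using ab(2) mod_eq_nat1E[of b p a] ab(3)[symmetric] by (metis mult.commute)
    then show ?thesis using mult[OF ab(1)] by simp
  qed
  have "d mod p = d' mod p"
    using assms(4) by (simp flip: of_nat_mod)
  then show ?thesis
    using le[of d d', OF assms(2)] le[of d' d, OF assms(3)] by (metis nat_le_linear)
qed

text \<open>Distances below \<open>N\<close> are listed one by one. From \<open>N\<close> on,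
  membership in \<open>D\<close> depends only on the residue of the distance, which the residues of
  the two endpoints determine.\<close>

lemma definable_gap:
  assumes X: "finite X" "x \<in> X" "y \<in> X"
    and "0 < p" and per: "\<And>d. d \<ge> N \<Longrightarrow> d + p \<in> D \<longleftrightarrow> d \<in> D"
  shows "definable X (\<lambda>\<A> \<sigma>. \<sigma> x \<le> \<sigma> y \<and> nat (\<sigma> y - \<sigma> x) \<in> D)"
proof -
  \<comment> \<open>Doubling keeps a period and makes the modulus exceed 1, as the language demands,
    even if \<open>p = 1\<close>.\<close>
  define r where "r = 2 * p"
  have r: "1 < r" using \<open>0 < p\<close> by (simp add: r_def)
  have per': "d + r \<in> D \<longleftrightarrow> d \<in> D" if "d \<ge> N" for d
    using per[OF that] per[of "d + p"] that by (simp add: r_def mult_2 add.assoc)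
  \<comment> \<open>Residue pairs witnessed by one long distance in \<open>D\<close>; by periodicity
    one witness decides for all long distances with these residues.\<close>
  define G where "G = {(a, b) \<in> {..<r} \<times> {..<r}. \<exists>d\<ge>N. d \<in> D \<and> int d mod int r = (int b - int a) mod int r}"
  have "finite G"
    unfolding G_def by (rule finite_subset[of _ "{..<r} \<times> {..<r}"]) auto
  have "definable X (\<lambda>\<A> \<sigma>. (\<exists>c\<in>{c. c < N \<and> c \<in> D}. \<sigma> y = \<sigma> x + int c) \<or>
      (\<sigma> x \<le> \<sigma> y \<and> (\<forall>c\<in>{..<N}. \<not> \<sigma> y = \<sigma> x + int c) \<and>
        (\<exists>g\<in>G. \<sigma> x mod int r = int (fst g) \<and> \<sigma> y mod int r = int (snd g))))"
    using X r \<open>finite G\<close>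
    by (intro definable_disj definable_conj definable_bex_finite definable_ball_finite
        definable_add definable_not definable_le definable_mod) (auto simp: G_def)
  then show ?thesis
  proof (rule definable_cong)
    fix \<A> :: data and \<sigma> :: "nat \<Rightarrow> int"
    show "((\<exists>c\<in>{c. c < N \<and> c \<in> D}. \<sigma> y = \<sigma> x + int c) \<or>
      (\<sigma> x \<le> \<sigma> y \<and> (\<forall>c\<in>{..<N}. \<not> \<sigma> y = \<sigma> x + int c) \<and>
        (\<exists>g\<in>G. \<sigma> x mod int r = int (fst g) \<and> \<sigma> y mod int r = int (snd g))))
      \<longleftrightarrow> \<sigma> x \<le> \<sigma> y \<and> nat (\<sigma> y - \<sigma> x) \<in> D" (is "?L \<longleftrightarrow> ?R")
    proof (cases "\<sigma> x \<le> \<sigma> y")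
      case False
      then show ?thesis by auto
    next
      case True
      define d where "d = nat (\<sigma> y - \<sigma> x)"
      have y: "\<sigma> y = \<sigma> x + int d" using True by (simp add: d_def)
      show ?thesis
      proof (cases "d < N")
        case True
        then show ?thesis using y by auto
      next
        case False
        define a where "a = nat (\<sigma> x mod int r)"
        define b where "b = nat (\<sigma> y mod int r)"
        have ab: "\<sigma> x mod int r = int a" "\<sigma> y mod int r = int b" "a < r" "b < r"
          using r by (simp_all add: a_def b_def nat_less_iff)
        have db: "int d mod int r = (int b - int a) mod int r"
          unfolding ab(1,2)[symmetric] by (simp add: y mod_diff_eq)
        have "?L \<longleftrightarrow> (a, b) \<in> G"
          using False y ab by (auto intro: bexI[of _ "(a, b)"])
        also have "\<dots> \<longleftrightarrow> d \<in> D"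
        proof
          assume "(a, b) \<in> G"
          then obtain e where "e \<ge> N" "e \<in> D" "int e mod int r = int d mod int r"
            using db by (auto simp: G_def)
          then show "d \<in> D"
            using ult_periodic_cong[of N r D e d] per' False by auto
        next
          assume "d \<in> D"
          then show "(a, b) \<in> G"
            using db ab False by (auto simp: G_def intro!: exI[of _ d])
        qed
        finally show ?thesis using y by simp
      qed
    qed
  qed
qed

text \<open>Positive powers of \<open>R\<close> live in a finite set, so two of them coincide, and
  composing both with \<open>R ^^ k\<close> gives a period from the first on.\<close>

lemma definable_relpow:
  fixes R :: "'s rel"
  assumes R: "finite R" and X: "finite X" "x \<in> X" "y \<in> X"
  shows "definable X (\<lambda>\<A> \<sigma>. \<sigma> x \<le> \<sigma> y \<and> (p, q) \<in> R ^^ nat (\<sigma> y - \<sigma> x))"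
proof -
  \<comment> \<open>Power 0 is left out: it is the identity on the whole, possibly infinite,
    type.\<close>
  have sub: "R ^^ Suc n \<subseteq> fst ` R \<times> snd ` R" for n
  proof -
    have "R ^^ n O R \<subseteq> UNIV \<times> snd ` R" "R O R ^^ n \<subseteq> fst ` R \<times> UNIV"
      by force+
    then show ?thesis
      unfolding relpow.simps using relpow_commute[of R n] by auto
  qed
  have "finite (range (\<lambda>n. R ^^ Suc n))"
    by (rule finite_subset[of _ "Pow (fst ` R \<times> snd ` R)"]) (use R sub in auto)
  then have "\<not> inj (\<lambda>n. R ^^ Suc n)"
    using finite_imageD infinite_UNIV_nat by blast
  then obtain i j where "i \<noteq> j" "R ^^ Suc i = R ^^ Suc j"
    unfolding inj_def by blast
  then obtain i j where ij: "i < j" "R ^^ Suc i = R ^^ Suc j"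
  proof (cases i j rule: linorder_cases)
    case less
    then show ?thesis using that \<open>R ^^ Suc i = R ^^ Suc j\<close> by blast
  next
    case equal
    then show ?thesis using \<open>i \<noteq> j\<close> by blast
  next
    case greater
    then show ?thesis using that \<open>R ^^ Suc i = R ^^ Suc j\<close>[symmetric] by blast
  qed
  have per: "R ^^ (d + (j - i)) = R ^^ d" if "d \<ge> Suc i" for d
  proof -
    obtain k where k: "d = Suc i + k" using \<open>d \<ge> Suc i\<close> le_Suc_ex by blast
    have "R ^^ (d + (j - i)) = R ^^ (Suc j + k)"
      using k ij(1) by (simp add: add.commute)
    also have "\<dots> = R ^^ (Suc i + k)"
      by (simp only: relpow_add ij(2))
    finally show ?thesis using k by simp
  qed
  have "definable X (\<lambda>\<A> \<sigma>. \<sigma> x \<le> \<sigma> y \<and> nat (\<sigma> y - \<sigma> x) \<in> {d. (p, q) \<in> R ^^ d})"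
    by (rule definable_gap[OF X, of "j - i" "Suc i"]) (use ij per in simp_all)
  then show ?thesis by simp
qed

section \<open>Majority-closed runs\<close>

definition maj :: "'a set \<Rightarrow> 'a set \<Rightarrow> 'a set \<Rightarrow> 'a set" where
  "maj a b c = (a \<inter> b) \<union> (b \<inter> c) \<union> (a \<inter> c)"

lemma maj_same [simp]: "maj a a a = a"
  by (auto simp: maj_def)

text \<open>On a single element at most one of the three sets differs from the majority. Two
  elements therefore exclude at most two sets, and one remains.\<close>

lemma maj_agrees_on_pair:
  assumes "finite L" "card L \<le> 2"
  shows "\<exists>s\<in>{a, b, c}. \<forall>\<chi>\<in>L. \<chi> \<in> maj a b c \<longleftrightarrow> \<chi> \<in> s"
proof -
  obtain x y where "L \<subseteq> {x, y}"
  proof -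
    consider "card L = 0" | "card L = 1" | "card L = 2" using assms(2) by linarith
    then show ?thesis
      using that assms(1)
      by cases (auto simp: card_1_singleton_iff card_2_iff)
  qed
  moreover have "\<exists>s\<in>{a, b, c}. \<forall>\<chi>\<in>{x, y}. \<chi> \<in> maj a b c \<longleftrightarrow> \<chi> \<in> s"
    by (auto simp: maj_def)
  ultimately show ?thesis by blast
qed

text \<open>Induction on the number of constraints. If three distinct ones exist, take for each a
  solution of all the others; every constraint then fails in at most one of the three solutions, and
  \<open>convex\<close> makes \<open>f\<close> satisfy it.\<close>

lemma helly:
  assumes "finite I" "\<exists>s. s \<in> S"
    and pair: "\<And>i j. i \<in> I \<Longrightarrow> j \<in> I \<Longrightarrow> \<exists>s\<in>S. P i s \<and> P j s"
    and closed: "\<And>a b c. a \<in> S \<Longrightarrow> b \<in> S \<Longrightarrow> c \<in> S \<Longrightarrow> f a b c \<in> S"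
    and convex: "\<And>i a b c. i \<in> I \<Longrightarrow> P i a \<and> P i b \<or> P i b \<and> P i c \<or> P i a \<and> P i c \<Longrightarrow> P i (f a b c)"
  shows "\<exists>s\<in>S. \<forall>i\<in>I. P i s"
proof -
  have "\<exists>s\<in>S. \<forall>i\<in>J. P i s" if "J \<subseteq> I" for J
    using finite_subset[OF that \<open>finite I\<close>] that
  proof (induction J rule: finite_psubset_induct)
    case (psubset J)
    consider "J = {}" | "J \<noteq> {}" "\<exists>i\<in>I. \<exists>j\<in>I. J \<subseteq> {i, j}"
      | "J \<noteq> {}" "\<not> (\<exists>i\<in>I. \<exists>j\<in>I. J \<subseteq> {i, j})" by blast
    then show ?case
    proof cases
      case 1
      then show ?thesis using assms(2) by blast
    next
      case 2
      then obtain i j where "i \<in> I" "j \<in> I" "J \<subseteq> {i, j}" by blast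
      then show ?thesis using pair[of i j] by blast
    next
      case 3
      then obtain i where i: "i \<in> J"
        using 3(1) by blast
      obtain j where j: "j \<in> J" "j \<noteq> i" using 3(2) i psubset.prems by blast
      obtain k where k: "k \<in> J" "k \<noteq> i" "k \<noteq> j" using 3(2) i j psubset.prems by blast
      have "\<exists>s\<in>S. \<forall>h\<in>J - {g}. P h s" if "g \<in> J" for g
        using psubset.IH[of "J - {g}"] that psubset.prems by blast
      then obtain a b c where "a \<in> S" "\<forall>h\<in>J - {i}. P h a" "b \<in> S" "\<forall>h\<in>J - {j}. P h b"
        "c \<in> S" "\<forall>h\<in>J - {k}. P h c"
        using i j(1) k(1) by meson
      moreover have "P h (f a b c)" if "h \<in> J" for h
      proof (rule convex)
        show "h \<in> I" using that psubset.prems by blast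
        show "P h a \<and> P h b \<or> P h b \<and> P h c \<or> P h a \<and> P h c"
          using calculation that j(2) k(2,3) by (cases "h = i"; cases "h = j") auto
      qed
      ultimately show ?thesis using closed by blast
    qed
  qed
  then show ?thesis by blast
qed

section \<open>Runs of a relation on an integer interval\<close>

definition path :: "'s rel \<Rightarrow> int \<Rightarrow> int \<Rightarrow> (int \<Rightarrow> 's) \<Rightarrow> bool" where
  "path R x y s \<longleftrightarrow> (\<forall>n. x \<le> n \<and> n < y \<longrightarrow> (s n, s (n + 1)) \<in> R)"

lemma path_subpath: "path R x y s \<Longrightarrow> x \<le> x' \<Longrightarrow> y' \<le> y \<Longrightarrow> path R x' y' s"
  by (auto simp: path_def)

lemma path_mono: "path R x y s \<Longrightarrow> R \<subseteq> R' \<Longrightarrow> path R' x y s"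
  by (auto simp: path_def)

lemma path_join:
  assumes "path R x z s" "path R (z + 1) y s'" "(s z, s' (z + 1)) \<in> R"
  shows "path R x y (\<lambda>n. if n \<le> z then s n else s' n)"
  unfolding path_def
proof (intro allI impI)
  fix n assume n: "x \<le> n \<and> n < y"
  consider "n < z" | "n = z" | "n > z" by linarith
  then show "(if n \<le> z then s n else s' n, if n + 1 \<le> z then s (n + 1) else s' (n + 1)) \<in> R"
    using assms n by cases (auto simp: path_def)
qed

lemma path_glue:
  assumes "path R x z s" "path R z y s'" "s z = s' z"
  shows "path R x y (\<lambda>n. if n \<le> z then s n else s' n)"
  unfolding path_def
proof (intro allI impI)
  fix n assume n: "x \<le> n \<and> n < y"
  consider "n < z" | "n = z" | "n > z" by linarith
  then show "(if n \<le> z then s n else s' n, if n + 1 \<le> z then s (n + 1) else s' (n + 1)) \<in> R"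
    using assms n by cases (auto simp: path_def)
qed

lemma path_relpow_iff:
  assumes "x \<le> y"
  shows "(p, q) \<in> R ^^ nat (y - x) \<longleftrightarrow> (\<exists>s. s x = p \<and> s y = q \<and> path R x y s)"
proof
  assume "(p, q) \<in> R ^^ nat (y - x)"
  then obtain f where f: "f 0 = p" "f (nat (y - x)) = q"
    "\<And>i. i < nat (y - x) \<Longrightarrow> (f i, f (Suc i)) \<in> R"
    by (auto simp: relpow_fun_conv)
  have "path R x y (\<lambda>n. f (nat (n - x)))"
    unfolding path_def
  proof (intro allI impI)
    fix n assume n: "x \<le> n \<and> n < y"
    then have "nat (n + 1 - x) = Suc (nat (n - x))" "nat (n - x) < nat (y - x)" by auto
    then show "(f (nat (n - x)), f (nat (n + 1 - x))) \<in> R" using f(3) by simp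
  qed
  then show "\<exists>s. s x = p \<and> s y = q \<and> path R x y s"
    using f(1,2) by (intro exI[of _ "\<lambda>n. f (nat (n - x))"]) auto
next
  assume "\<exists>s. s x = p \<and> s y = q \<and> path R x y s"
  then obtain s where s: "s x = p" "s y = q" "path R x y s" by blast
  have "(s (x + int i), s (x + int (Suc i))) \<in> R" if "i < nat (y - x)" for i
    using s(3) that by (auto simp: path_def ac_simps dest: spec[of _ "x + int i"])
  then show "(p, q) \<in> R ^^ nat (y - x)"
    using s(1,2) assms by (auto simp: relpow_fun_conv intro!: exI[of _ "\<lambda>i. s (x + int i)"])
qed

text \<open>Fixing the types at two instants cuts a run into three independent pieces. This turns
  the question about two literals into one about powers.\<close>

lemma path_through_two_iff:
  assumes "x \<le> i" "i \<le> j" "j \<le> y"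
  shows "(\<exists>s. s x = p \<and> s i = u \<and> s j = v \<and> s y = q \<and> path R x y s) \<longleftrightarrow>
    (p, u) \<in> R ^^ nat (i - x) \<and> (u, v) \<in> R ^^ nat (j - i) \<and> (v, q) \<in> R ^^ nat (y - j)"
    (is "?L \<longleftrightarrow> ?R")
proof
  assume ?L
  then obtain s where s: "s x = p" "s i = u" "s j = v" "s y = q" "path R x y s" by blast
  then have "path R x i s" "path R i j s" "path R j y s"
    using assms by (auto intro: path_subpath)
  then show ?R
    using s assms by (auto simp only: path_relpow_iff)
next
  assume ?R
  then obtain s1 s2 s3 where s: "s1 x = p" "s1 i = u" "path R x i s1"
    "s2 i = u" "s2 j = v" "path R i j s2" "s3 j = v" "s3 y = q" "path R j y s3"
    using assms by (auto simp: path_relpow_iff)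
  let ?t = "\<lambda>n. if n \<le> j then s2 n else s3 n"
  have t: "path R i y ?t" using path_glue[OF s(6,9)] s by simp
  have "path R x y (\<lambda>n. if n \<le> i then s1 n else ?t n)"
    by (rule path_glue[OF s(3) t]) (use s assms in auto)
  then show ?L
    using s assms by (intro exI[of _ "\<lambda>n. if n \<le> i then s1 n else ?t n"]) auto
qed

text \<open>In the language of constraint satisfaction, \<open>maj\<close> is a polymorphism of
  \<open>R\<close>.\<close>

definition maj_closed :: "'a set rel \<Rightarrow> bool" where
  "maj_closed R \<longleftrightarrow> (\<forall>a a' b b' c c'. (a, a') \<in> R \<longrightarrow> (b, b') \<in> R \<longrightarrow> (c, c') \<in> R \<longrightarrow>
     (maj a b c, maj a' b' c') \<in> R)"

fun holds :: "'a \<times> bool \<Rightarrow> 'a set \<Rightarrow> bool" where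
  "holds (v, b) s \<longleftrightarrow> (v \<in> s \<longleftrightarrow> b)"

lemma holds_maj:
  "holds e a \<and> holds e b \<or> holds e b \<and> holds e c \<or> holds e a \<and> holds e c \<Longrightarrow> holds e (maj a b c)"
  by (cases e) (auto simp: maj_def)

text \<open>The Helly lemma for whole runs, with majority taken at every instant. The prescribed end
  types survive because the majority of three equal sets is that set.\<close>

lemma maj_closed_path_helly:
  assumes R: "maj_closed R" and "finite I"
    and "\<exists>s. s x = p \<and> s y = q \<and> path R x y s"
    and "\<And>i e j e'. (i, e) \<in> I \<Longrightarrow> (j, e') \<in> I \<Longrightarrow>
      \<exists>s. s x = p \<and> s y = q \<and> path R x y s \<and> holds e (s i) \<and> holds e' (s j)"
  shows "\<exists>s. s x = p \<and> s y = q \<and> path R x y s \<and> (\<forall>(i, e)\<in>I. holds e (s i))"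
proof -
  let ?S = "{s. s x = p \<and> s y = q \<and> path R x y s}"
  have "\<exists>s\<in>?S. \<forall>g\<in>I. holds (snd g) (s (fst g))"
  proof (rule helly[where f = "\<lambda>a b c n. maj (a n) (b n) (c n)"])
    fix a b c assume "a \<in> ?S" "b \<in> ?S" "c \<in> ?S"
    then show "(\<lambda>n. maj (a n) (b n) (c n)) \<in> ?S"
      using R unfolding path_def maj_closed_def by simp
  next
    fix g h assume "g \<in> I" "h \<in> I"
    then show "\<exists>s\<in>?S. holds (snd g) (s (fst g)) \<and> holds (snd h) (s (fst h))"
      using assms(4)[of "fst g" "snd g" "fst h" "snd h"] by simp
  next
    show "\<exists>s. s \<in> ?S" using assms(3) by simp
  qed (rule \<open>finite I\<close>, rule holds_maj)
  then show ?thesis by (auto simp: case_prod_beta)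
qed

section \<open>Types over the closure of an ontology\<close>

text \<open>Boolean operators are not opened, since the closure is formed from prefixed atoms
  only.\<close>

primrec subs :: "ltl \<Rightarrow> ltl set" where
  "subs (Atom B) = {Atom B}"
| "subs (Temp u \<phi>) = insert (Temp u \<phi>) (subs \<phi>)"
| "subs (BoolOp f \<phi>s) = {BoolOp f \<phi>s}"

lemma finite_subs: "finite (subs \<phi>)"
  by (induction \<phi>) auto

lemma self_in_subs: "\<phi> \<in> subs \<phi>"
  by (cases \<phi>) auto

lemma subs_Temp: "Temp u \<chi> \<in> subs \<phi> \<Longrightarrow> \<chi> \<in> subs \<phi>"
  by (induction \<phi>) (auto simp: self_in_subs)

lemma prefixed_atom_subs: "prefixed_atom \<phi> \<Longrightarrow> \<chi> \<in> subs \<phi> \<Longrightarrow> prefixed_atom \<chi>"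
  by (induction rule: prefixed_atom.induct) (auto intro: prefixed_atom.intros)

text \<open>Only the values of the generators at one instant matter, so truth can be carried to
  another interpretation and another instant.\<close>

lemma bool_comb_sem_cong:
  assumes "bool_comb L \<phi>" "\<And>\<chi>. \<chi> \<in> L \<Longrightarrow> n \<in> ltl_sem M \<chi> \<longleftrightarrow> n' \<in> ltl_sem M' \<chi>"
  shows "n \<in> ltl_sem M \<phi> \<longleftrightarrow> n' \<in> ltl_sem M' \<phi>"
  using assms
proof (induction rule: bool_comb.induct)
  case (oper \<phi>s f)
  then have "map (\<lambda>X. n \<in> X) (map (ltl_sem M) \<phi>s) = map (\<lambda>X. n' \<in> X) (map (ltl_sem M') \<phi>s)"
    by simp
  then show ?case by (simp only: ltl_sem.simps mem_Collect_eq)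
qed auto

lemma ltl_sem_shift: "ltl_sem (\<lambda>B. {n. n + k \<in> M B}) \<phi> = {n. n + k \<in> ltl_sem M \<phi>}"
proof (induction \<phi>)
  case (Temp u \<phi>)
  have fut: "(\<forall>j>n. Q (j + k)) \<longleftrightarrow> (\<forall>j>n + k. Q j)" for n :: int and Q
  proof
    assume *: "\<forall>j>n. Q (j + k)"
    show "\<forall>j>n + k. Q j"
    proof (intro allI impI)
      fix j assume "n + k < j"
      then show "Q j" using *[rule_format, of "j - k"] by simp
    qed
  qed simp
  have past: "(\<forall>j<n. Q (j + k)) \<longleftrightarrow> (\<forall>j<n + k. Q j)" for n :: int and Q
  proof
    assume *: "\<forall>j<n. Q (j + k)"
    show "\<forall>j<n + k. Q j"
    proof (intro allI impI)
      fix j assume "j < n + k"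
      then show "Q j" using *[rule_format, of "j - k"] by simp
    qed
  qed simp
  have fut': "(\<exists>j>n. Q (j + k)) \<longleftrightarrow> (\<exists>j>n + k. Q j)" for n :: int and Q
    using fut[of n "\<lambda>j. \<not> Q j"] by blast
  have past': "(\<exists>j<n. Q (j + k)) \<longleftrightarrow> (\<exists>j<n + k. Q j)" for n :: int and Q
    using past[of n "\<lambda>j. \<not> Q j"] by blast
  show ?case
    using fut[of _ "\<lambda>j. j \<in> ltl_sem M \<phi>"] past[of _ "\<lambda>j. j \<in> ltl_sem M \<phi>"]
      fut'[of _ "\<lambda>j. j \<in> ltl_sem M \<phi>"] past'[of _ "\<lambda>j. j \<in> ltl_sem M \<phi>"]
    by (cases u) (simp_all add: Temp algebra_simps)
next
  case (BoolOp f \<phi>s)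
  then have "map (\<lambda>X. n \<in> X) (map (ltl_sem (\<lambda>B. {n. n + k \<in> M B})) \<phi>s) =
      map (\<lambda>X. n + k \<in> X) (map (ltl_sem M) \<phi>s)" for n
    by simp
  then show ?case by (simp only: ltl_sem.simps mem_Collect_eq)
qed simp

section \<open>Boxes determined by one-step laws and a tail\<close>

lemma all_greater_step: "(\<forall>k>n. P k) \<longleftrightarrow> P (n + 1) \<and> (\<forall>k>n + 1. P k)" for n :: int
proof -
  have "k > n \<longleftrightarrow> k = n + 1 \<or> k > n + 1" for k by linarith
  then show ?thesis by auto
qed

lemma all_less_step: "(\<forall>k<n + 1. P k) \<longleftrightarrow> P n \<and> (\<forall>k<n. P k)" for n :: int
proof -
  have "k < n + 1 \<longleftrightarrow> k = n \<or> k < n" for k by linarith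
  then show ?thesis by auto
qed

text \<open>The step law propagates the correct value leftwards from the tail. The tail condition
  carries information: a constantly false \<open>P\<close> satisfies the step law for every
  \<open>Q\<close>.\<close>

lemma all_greater_backward:
  fixes P Q :: "int \<Rightarrow> bool"
  assumes step: "\<And>n. P n \<longleftrightarrow> P (n + 1) \<and> Q (n + 1)"
    and "end": "\<And>n. n \<ge> m \<Longrightarrow> P n \<longleftrightarrow> (\<forall>k>n. Q k)"
  shows "P n \<longleftrightarrow> (\<forall>k>n. Q k)"
proof (cases "n \<le> m")
  case True
  then show ?thesis
  proof (induction n rule: int_le_induct)
    case base
    then show ?case using "end" by simp
  next
    case (step i)
    then show ?case using assms(1)[of "i - 1"] all_greater_step[of "i - 1" Q] by auto
  qed
qed (use "end" in simp)

lemma all_less_forward: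
  fixes P Q :: "int \<Rightarrow> bool"
  assumes step: "\<And>n. P (n + 1) \<longleftrightarrow> P n \<and> Q n"
    and "end": "\<And>n. n \<le> m \<Longrightarrow> P n \<longleftrightarrow> (\<forall>k<n. Q k)"
  shows "P n \<longleftrightarrow> (\<forall>k<n. Q k)"
proof (cases "m \<le> n")
  case True
  then show ?thesis
  proof (induction n rule: int_ge_induct)
    case base
    then show ?case using "end" by simp
  next
    case (step i)
    then show ?case using assms(1)[of i] all_less_step[of i Q] by auto
  qed
qed (use "end" in simp)

locale krom_closure =
  fixes \<O> :: "ltl set" and A :: concept and gens :: "ltl \<Rightarrow> ltl set"
  assumes finite_ontology: "finite \<O>"
    and gens: "\<alpha> \<in> \<O> \<Longrightarrow> finite (gens \<alpha>) \<and> card (gens \<alpha>) \<le> 2 \<and>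
      (\<forall>\<chi>\<in>gens \<alpha>. prefixed_atom \<chi>) \<and> bool_comb (gens \<alpha>) \<alpha>"
begin

text \<open>The query atom is added because its falsity at the tested instant must be visible in a
  type even if no axiom mentions it.\<close>

definition cl :: "ltl set" where
  "cl = (\<Union>\<chi>\<in>insert (Atom A) (\<Union>\<alpha>\<in>\<O>. gens \<alpha>). subs \<chi>)"

lemma finite_cl: "finite cl"
  using finite_ontology gens by (auto simp: cl_def finite_subs)

lemma cl_Temp: "Temp u \<chi> \<in> cl \<Longrightarrow> \<chi> \<in> cl"
  unfolding cl_def using subs_Temp by blast

lemma cl_gens: "\<alpha> \<in> \<O> \<Longrightarrow> gens \<alpha> \<subseteq> cl"
  unfolding cl_def using self_in_subs by blast

lemma cl_query: "Atom A \<in> cl"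
  by (simp add: cl_def)

lemma cl_prefixed: "\<chi> \<in> cl \<Longrightarrow> prefixed_atom \<chi>"
  unfolding cl_def using gens prefixed_atom_subs by (auto intro: prefixed_atom.intros)

text \<open>Propositional satisfaction of every axiom by \<open>s\<close>. The arbitrary
  \<open>M\<close> and \<open>n\<close> only lend truth values to the generators, and by
  \<open>bool_comb_sem_cong\<close> these values decide the axiom.\<close>

definition good :: "ltl set \<Rightarrow> bool" where
  "good s \<longleftrightarrow> (\<forall>\<alpha>\<in>\<O>. \<exists>M n. n \<in> ltl_sem M \<alpha> \<and> (\<forall>\<chi>\<in>gens \<alpha>. \<chi> \<in> s \<longleftrightarrow> n \<in> ltl_sem M \<chi>))"

text \<open>The expansion laws of the operators. They leave open what happens at infinity.\<close>

fun expansion :: "tempop \<Rightarrow> ltl \<Rightarrow> ltl set \<Rightarrow> ltl set \<Rightarrow> bool" where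
  "expansion Next_F \<chi> s s' \<longleftrightarrow> (Temp Next_F \<chi> \<in> s \<longleftrightarrow> \<chi> \<in> s')"
| "expansion Next_P \<chi> s s' \<longleftrightarrow> (Temp Next_P \<chi> \<in> s' \<longleftrightarrow> \<chi> \<in> s)"
| "expansion Box_F \<chi> s s' \<longleftrightarrow> (Temp Box_F \<chi> \<in> s \<longleftrightarrow> Temp Box_F \<chi> \<in> s' \<and> \<chi> \<in> s')"
| "expansion Box_P \<chi> s s' \<longleftrightarrow> (Temp Box_P \<chi> \<in> s' \<longleftrightarrow> Temp Box_P \<chi> \<in> s \<and> \<chi> \<in> s)"
| "expansion Dia_F \<chi> s s' \<longleftrightarrow> (Temp Dia_F \<chi> \<in> s \<longleftrightarrow> Temp Dia_F \<chi> \<in> s' \<or> \<chi> \<in> s')"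
| "expansion Dia_P \<chi> s s' \<longleftrightarrow> (Temp Dia_P \<chi> \<in> s' \<longleftrightarrow> Temp Dia_P \<chi> \<in> s \<or> \<chi> \<in> s)"

definition trans_rel :: "ltl set rel" where
  "trans_rel = {(s, s'). s \<subseteq> cl \<and> s' \<subseteq> cl \<and> good s \<and> good s' \<and>
     (\<forall>u \<chi>. Temp u \<chi> \<in> cl \<longrightarrow> expansion u \<chi> s s')}"

definition rising :: "ltl set" where
  "rising = {\<phi> \<in> cl. \<exists>\<chi>. \<phi> = Temp Box_F \<chi> \<or> \<phi> = Temp Dia_P \<chi>}"

definition falling :: "ltl set" where
  "falling = {\<phi> \<in> cl. \<exists>\<chi>. \<phi> = Temp Box_P \<chi> \<or> \<phi> = Temp Dia_F \<chi>}"

text \<open>Counts the monotone formulas that have reached their final value. The rank never drops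
  along a run, so its maximum bounds the number of changes.\<close>

definition rank :: "ltl set \<Rightarrow> nat" where
  "rank s = card (rising \<inter> s) + card (falling - s)"

definition stay :: "ltl set \<Rightarrow> ltl set rel" where
  "stay b = {(s, s') \<in> trans_rel. s \<inter> (rising \<union> falling) = b \<and> s' \<inter> (rising \<union> falling) = b}"

lemma finite_rising: "finite rising" and finite_falling: "finite falling"
  using finite_cl by (simp_all add: rising_def falling_def)

lemma finite_stay: "finite (stay b)"
  by (rule finite_subset[of _ "Pow cl \<times> Pow cl"]) (use finite_cl in \<open>auto simp: stay_def trans_rel_def\<close>)

lemma stay_subset_trans: "stay b \<subseteq> trans_rel"
  by (auto simp: stay_def)

lemma rank_le: "rank s \<le> card rising + card falling"
  unfolding rank_def by (intro add_mono card_mono) (auto simp: finite_rising finite_falling)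

lemma trans_monotone:
  assumes "(s, s') \<in> trans_rel"
  shows "rising \<inter> s \<subseteq> rising \<inter> s'" "falling - s \<subseteq> falling - s'"
proof -
  have e: "expansion u \<chi> s s'" if "Temp u \<chi> \<in> cl" for u \<chi>
    using assms that by (auto simp: trans_rel_def)
  show "rising \<inter> s \<subseteq> rising \<inter> s'" "falling - s \<subseteq> falling - s'"
    using e by (fastforce simp: rising_def falling_def)+
qed

lemma rank_mono: "(s, s') \<in> trans_rel \<Longrightarrow> rank s \<le> rank s'"
  unfolding rank_def
  by (intro add_mono card_mono trans_monotone) (simp_all add: finite_rising finite_falling)

text \<open>Both summands of the rank are monotone, so an equal sum makes each of them equal;
  inclusions between finite sets of equal size are equalities.\<close>

lemma rank_eq_stay:
  assumes "(s, s') \<in> trans_rel" "rank s = rank s'"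
  shows "s \<inter> (rising \<union> falling) = s' \<inter> (rising \<union> falling)"
proof -
  note sub = trans_monotone[OF assms(1)]
  have "card (rising \<inter> s) \<le> card (rising \<inter> s')" "card (falling - s) \<le> card (falling - s')"
    using sub by (auto intro!: card_mono simp: finite_rising finite_falling)
  then have "card (rising \<inter> s) = card (rising \<inter> s')" "card (falling - s) = card (falling - s')"
    using assms(2) unfolding rank_def by linarith+
  then have "rising \<inter> s = rising \<inter> s'" "falling - s = falling - s'"
    using card_subset_eq[OF _ sub(1)] card_subset_eq[OF _ sub(2)]
    by (simp_all add: finite_rising finite_falling)
  then show ?thesis by blast
qed

text \<open>This is where the Krom restriction acts: an axiom sees at most two formulas, and on
  these the majority coincides with one of the three good types.\<close>

lemma good_maj:
  assumes "good a" "good b" "good c"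
  shows "good (maj a b c)"
  unfolding good_def
proof
  fix \<alpha> assume \<alpha>: "\<alpha> \<in> \<O>"
  obtain s where s: "s \<in> {a, b, c}" "\<forall>\<chi>\<in>gens \<alpha>. \<chi> \<in> maj a b c \<longleftrightarrow> \<chi> \<in> s"
    using maj_agrees_on_pair[of "gens \<alpha>" a b c] gens[OF \<alpha>] by blast
  then have "good s" using assms by blast
  then show "\<exists>M n. n \<in> ltl_sem M \<alpha> \<and> (\<forall>\<chi>\<in>gens \<alpha>. \<chi> \<in> maj a b c \<longleftrightarrow> n \<in> ltl_sem M \<chi>)"
    using s(2) \<alpha> unfolding good_def by metis
qed

text \<open>
  With the box and diamond formulas frozen to \<open>b\<close>, every expansion law relates at most two
  remaining literals.
\<close>

lemma maj_closed_stay: "maj_closed (stay b)"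
  unfolding maj_closed_def
proof (intro allI impI)
  fix a1 a2 b1 b2 c1 c2
  assume st: "(a1, a2) \<in> stay b" "(b1, b2) \<in> stay b" "(c1, c2) \<in> stay b"
  let ?m1 = "maj a1 b1 c1" and ?m2 = "maj a2 b2 c2"
  have tr: "(a1, a2) \<in> trans_rel" "(b1, b2) \<in> trans_rel" "(c1, c2) \<in> trans_rel"
    using st stay_subset_trans by blast+
  have "expansion u \<chi> ?m1 ?m2" if cl: "Temp u \<chi> \<in> cl" for u \<chi>
  proof -
    have e: "expansion u \<chi> a1 a2" "expansion u \<chi> b1 b2" "expansion u \<chi> c1 c2"
      using tr cl unfolding trans_rel_def by blast+
    have same: "(\<phi> \<in> a1 \<longleftrightarrow> \<phi> \<in> b) \<and> (\<phi> \<in> b1 \<longleftrightarrow> \<phi> \<in> b) \<and> (\<phi> \<in> c1 \<longleftrightarrow> \<phi> \<in> b) \<and>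
        (\<phi> \<in> a2 \<longleftrightarrow> \<phi> \<in> b) \<and> (\<phi> \<in> b2 \<longleftrightarrow> \<phi> \<in> b) \<and> (\<phi> \<in> c2 \<longleftrightarrow> \<phi> \<in> b)"
      if "\<phi> \<in> rising \<union> falling" for \<phi>
      using st that unfolding stay_def by blast
    show ?thesis
    proof (cases u)
      case Next_F
      then show ?thesis using e by (auto simp: maj_def)
    next
      case Next_P
      then show ?thesis using e by (auto simp: maj_def)
    \<comment> \<open>With one common value of \<open>Temp u \<chi>\<close> in all six types, the
      law is either vacuous or prescribes the value of \<open>\<chi>\<close> on one side; majority
      keeps a prescribed value.\<close>
    qed (use e cl same[of "Temp u \<chi>"] in \<open>simp_all add: maj_def rising_def falling_def, blast+\<close>)
  qed
  moreover have "good ?m1" "good ?m2" "?m1 \<subseteq> cl" "?m2 \<subseteq> cl"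
    using tr good_maj unfolding trans_rel_def maj_def by blast+
  moreover have "?m1 \<inter> (rising \<union> falling) = b" "?m2 \<inter> (rising \<union> falling) = b"
    using st unfolding stay_def maj_def by blast+
  ultimately show "(?m1, ?m2) \<in> stay b"
    by (simp add: stay_def trans_rel_def)
qed

subsection \<open>Runs and models\<close>

definition tp :: "interp \<Rightarrow> int \<Rightarrow> ltl set" where
  "tp M n = {\<chi> \<in> cl. n \<in> ltl_sem M \<chi>}"

lemma tp_shift: "tp (\<lambda>B. {n. n + k \<in> M B}) n = tp M (n + k)"
  by (simp add: tp_def ltl_sem_shift)

lemma ontology_model_shift:
  "ontology_model M \<O> \<Longrightarrow> ontology_model (\<lambda>B. {n. n + k \<in> M B}) \<O>"
  by (auto simp: ontology_model_def ltl_sem_shift)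

lemma good_tp: "ontology_model M \<O> \<Longrightarrow> good (tp M n)"
  using cl_gens unfolding good_def ontology_model_def tp_def by blast

lemma expansion_tp:
  assumes "Temp u \<chi> \<in> cl"
  shows "expansion u \<chi> (tp M n) (tp M (n + 1))"
proof -
  have f: "(\<exists>k>n. P k) \<longleftrightarrow> P (n + 1) \<or> (\<exists>k>n + 1. P k)" for P
    using all_greater_step[of n "\<lambda>k. \<not> P k"] by blast
  have p: "(\<exists>k<n + 1. P k) \<longleftrightarrow> P n \<or> (\<exists>k<n. P k)" for P
    using all_less_step[of n "\<lambda>k. \<not> P k"] by blast
  let ?P = "\<lambda>k. k \<in> ltl_sem M \<chi>"
  show ?thesis
    using assms cl_Temp[OF assms] all_greater_step[of n ?P] all_less_step[of n ?P] f[of ?P] p[of ?P]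
    by (cases u) (auto simp: tp_def)
qed

lemma trans_tp: "ontology_model M \<O> \<Longrightarrow> (tp M n, tp M (n + 1)) \<in> trans_rel"
  by (simp add: trans_rel_def good_tp expansion_tp) (auto simp: tp_def)

text \<open>
  The laws at infinity, on which \<open>trans_rel\<close> is silent, are inherited from the two models.
\<close>

lemma run_is_tp:
  assumes run: "\<And>n. (s n, s (n + 1)) \<in> trans_rel"
    and left: "\<And>n. n \<le> 0 \<Longrightarrow> s n = tp M1 n"
    and right: "\<And>n. n \<ge> m \<Longrightarrow> s n = tp M2 n"
  defines "M \<equiv> \<lambda>B. {n. Atom B \<in> cl \<longrightarrow> Atom B \<in> s n}"
  shows "tp M = s"
proof -
  have e: "expansion u \<chi> (s n) (s (n + 1))" if "Temp u \<chi> \<in> cl" for u \<chi> n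
    using run[of n] that by (auto simp: trans_rel_def)
  have "prefixed_atom \<chi> \<Longrightarrow> \<chi> \<in> cl \<Longrightarrow> \<forall>n. n \<in> ltl_sem M \<chi> \<longleftrightarrow> \<chi> \<in> s n" for \<chi>
  proof (induction rule: prefixed_atom.induct)
    case (1 B)
    then show ?case by (simp add: M_def)
  next
    case (2 \<chi> u)
    have IH: "n \<in> ltl_sem M \<chi> \<longleftrightarrow> \<chi> \<in> s n" for n
      using 2 cl_Temp by blast
    note ex = e[OF 2(3)]
    have fut: "Temp u \<chi> \<in> s n \<longleftrightarrow> n \<in> ltl_sem M2 (Temp u \<chi>)"
      and fut_arg: "\<chi> \<in> s n \<longleftrightarrow> n \<in> ltl_sem M2 \<chi>" if "n \<ge> m" for n
      using right[OF that] 2(3) cl_Temp[OF 2(3)] by (auto simp: tp_def)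
    have past: "Temp u \<chi> \<in> s n \<longleftrightarrow> n \<in> ltl_sem M1 (Temp u \<chi>)"
      and past_arg: "\<chi> \<in> s n \<longleftrightarrow> n \<in> ltl_sem M1 \<chi>" if "n \<le> 0" for n
      using left[OF that] 2(3) cl_Temp[OF 2(3)] by (auto simp: tp_def)
    have neg: "\<not> (\<forall>k>n. \<chi> \<notin> s k) \<longleftrightarrow> (\<exists>k>n. \<chi> \<in> s k)" "\<not> (\<forall>k<n. \<chi> \<notin> s k) \<longleftrightarrow> (\<exists>k<n. \<chi> \<in> s k)" for n
      by blast+
    show ?case
    proof
      fix n
      show "n \<in> ltl_sem M (Temp u \<chi>) \<longleftrightarrow> Temp u \<chi> \<in> s n"
      proof (cases u)
        case Next_F
        then show ?thesis using ex[of n] IH by simp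
      next
        case Next_P
        then show ?thesis using ex[of "n - 1"] IH by simp
      next
        case Box_F
        then have "Temp u \<chi> \<in> s n \<longleftrightarrow> (\<forall>k>n. \<chi> \<in> s k)"
        proof (intro all_greater_backward[where P = "\<lambda>n. Temp u \<chi> \<in> s n" and Q = "\<lambda>n. \<chi> \<in> s n" and n = n and m = m])
          fix n
          show "(Temp u \<chi> \<in> s n) = (Temp u \<chi> \<in> s (n + 1) \<and> \<chi> \<in> s (n + 1))"
            using ex[of n] \<open>u = Box_F\<close> by simp
          show "n \<ge> m \<Longrightarrow> (Temp u \<chi> \<in> s n) = (\<forall>k>n. \<chi> \<in> s k)"
            using fut[of n] fut_arg \<open>u = Box_F\<close> by simp
        qed
        then show ?thesis using Box_F IH by simp
      next
        case Dia_F
        \<comment> \<open>A negated diamond obeys the law of a box over the negated argument, so the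
          same induction applies.\<close>
        then have "Temp u \<chi> \<notin> s n \<longleftrightarrow> (\<forall>k>n. \<chi> \<notin> s k)"
        proof (intro all_greater_backward[where P = "\<lambda>n. Temp u \<chi> \<notin> s n" and Q = "\<lambda>n. \<chi> \<notin> s n" and n = n and m = m])
          fix n
          show "(Temp u \<chi> \<notin> s n) = (Temp u \<chi> \<notin> s (n + 1) \<and> \<chi> \<notin> s (n + 1))"
            using ex[of n] \<open>u = Dia_F\<close> by simp
          show "n \<ge> m \<Longrightarrow> (Temp u \<chi> \<notin> s n) = (\<forall>k>n. \<chi> \<notin> s k)"
            using fut[of n] fut_arg \<open>u = Dia_F\<close> by simp
        qed
        then show ?thesis using Dia_F IH neg by simp blast
      next
        case Box_P
        then have "Temp u \<chi> \<in> s n \<longleftrightarrow> (\<forall>k<n. \<chi> \<in> s k)"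
        proof (intro all_less_forward[where P = "\<lambda>n. Temp u \<chi> \<in> s n" and Q = "\<lambda>n. \<chi> \<in> s n" and n = n and m = 0])
          fix n
          show "(Temp u \<chi> \<in> s (n + 1)) = (Temp u \<chi> \<in> s n \<and> \<chi> \<in> s n)"
            using ex[of n] \<open>u = Box_P\<close> by simp
          show "n \<le> 0 \<Longrightarrow> (Temp u \<chi> \<in> s n) = (\<forall>k<n. \<chi> \<in> s k)"
            using past[of n] past_arg \<open>u = Box_P\<close> by simp
        qed
        then show ?thesis using Box_P IH by simp
      next
        case Dia_P
        then have "Temp u \<chi> \<notin> s n \<longleftrightarrow> (\<forall>k<n. \<chi> \<notin> s k)"
        proof (intro all_less_forward[where P = "\<lambda>n. Temp u \<chi> \<notin> s n" and Q = "\<lambda>n. \<chi> \<notin> s n" and n = n and m = 0])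
          fix n
          show "(Temp u \<chi> \<notin> s (n + 1)) = (Temp u \<chi> \<notin> s n \<and> \<chi> \<notin> s n)"
            using ex[of n] \<open>u = Dia_P\<close> by simp
          show "n \<le> 0 \<Longrightarrow> (Temp u \<chi> \<notin> s n) = (\<forall>k<n. \<chi> \<notin> s k)"
            using past[of n] past_arg \<open>u = Dia_P\<close> by simp
        qed
        then show ?thesis using Dia_P IH neg by simp blast
      qed
    qed
  qed
  then show ?thesis
    using run cl_prefixed unfolding tp_def trans_rel_def by blast
qed

subsection \<open>Definability of runs\<close>

text \<open>A pair \<open>(\<chi>, b)\<close> is the literal that gives \<open>\<chi>\<close> the truth value \<open>b\<close>.\<close>

definition lits :: "(ltl \<times> bool) set" where
  "lits = insert (Atom A, False) (cl \<times> {True})"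

text \<open>Positive literals come from the data. The only negative one in \<open>lits\<close>
  concerns the query atom and is imposed at the tested instant \<open>l\<close>, so obeying all
  active literals describes a countermodel.\<close>

fun active :: "data \<Rightarrow> int \<Rightarrow> ltl \<times> bool \<Rightarrow> int \<Rightarrow> bool" where
  "active \<A> l (\<chi>, b) n \<longleftrightarrow> (if b then \<exists>B. \<chi> = Atom B \<and> (B, n) \<in> \<A> else n = l)"

definition obeys :: "data \<Rightarrow> int \<Rightarrow> int \<Rightarrow> int \<Rightarrow> (int \<Rightarrow> ltl set) \<Rightarrow> bool" where
  "obeys \<A> l x y s \<longleftrightarrow> (\<forall>n\<in>{x..y}. \<forall>e\<in>lits. active \<A> l e n \<longrightarrow> holds e (s n))"

lemma obeysD:
  "obeys \<A> l x y s \<Longrightarrow> active \<A> l e n \<Longrightarrow> e \<in> lits \<Longrightarrow> x \<le> n \<Longrightarrow> n \<le> y \<Longrightarrow> holds e (s n)"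
  by (simp add: obeys_def)

definition seg :: "ltl set \<Rightarrow> ltl set \<Rightarrow> data \<Rightarrow> int \<Rightarrow> int \<Rightarrow> int \<Rightarrow> bool" where
  "seg p q \<A> l x y \<longleftrightarrow> x \<le> y \<and>
     (\<exists>s. s x = p \<and> s y = q \<and> path (stay (p \<inter> (rising \<union> falling))) x y s \<and> obeys \<A> l x y s)"

text \<open>At most \<open>k\<close> transitions are exempt from freezing; these are the places
  where monotone formulas may change. The successor \<open>w\<close> is quantified separately
  because the language has no terms.\<close>

primrec reach :: "nat \<Rightarrow> ltl set \<Rightarrow> ltl set \<Rightarrow> data \<Rightarrow> int \<Rightarrow> int \<Rightarrow> int \<Rightarrow> bool" where
  "reach 0 p q \<A> l x y \<longleftrightarrow> seg p q \<A> l x y"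
| "reach (Suc k) p q \<A> l x y \<longleftrightarrow> seg p q \<A> l x y \<or>
    (\<exists>z\<in>tem \<A>. \<exists>w\<in>tem \<A>. \<exists>(u, v)\<in>trans_rel. w = z + 1 \<and> seg p u \<A> l x z \<and> reach k v q \<A> l w y)"

lemma finite_lits: "finite lits"
  by (simp add: lits_def finite_cl)

lemma finite_trans: "finite trans_rel"
  by (rule finite_subset[of _ "Pow cl \<times> Pow cl"]) (use finite_cl in \<open>auto simp: trans_rel_def\<close>)

lemma path_trans_subset_cl:
  assumes "path trans_rel x y s" "s x \<subseteq> cl" "x \<le> n" "n \<le> y"
  shows "s n \<subseteq> cl"
proof (cases "n = x")
  case False
  then have "(s (n - 1), s (n - 1 + 1)) \<in> trans_rel"
    using assms unfolding path_def by (metis add1_zle_eq diff_add_cancel order_le_less zle_diff1_eq)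
  then show ?thesis by (simp add: trans_rel_def)
qed (use assms in simp)

text \<open>The pairwise premise of the Helly lemma, written with powers. The types \<open>u\<close>
  and \<open>v\<close> range over a finite set and become finite disjunctions; each inequality next
  to a power matches the form supplied by \<open>definable_relpow\<close>.\<close>

definition compatible ::
  "ltl set rel \<Rightarrow> ltl set \<Rightarrow> ltl set \<Rightarrow> data \<Rightarrow> int \<Rightarrow> int \<Rightarrow> int \<Rightarrow> int \<Rightarrow> int \<Rightarrow> bool" where
  "compatible R p q \<A> l x y i j \<longleftrightarrow> (x \<le> i \<and> i \<le> j \<and> j \<le> y) \<longrightarrow>
     (\<forall>e\<in>lits. \<forall>e'\<in>lits. active \<A> l e i \<and> active \<A> l e' j \<longrightarrow>
       (\<exists>u\<in>{u \<in> Pow cl. holds e u}. \<exists>v\<in>{v \<in> Pow cl. holds e' v}.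
         (x \<le> i \<and> (p, u) \<in> R ^^ nat (i - x)) \<and> (i \<le> j \<and> (u, v) \<in> R ^^ nat (j - i)) \<and>
         (j \<le> y \<and> (v, q) \<in> R ^^ nat (y - j))))"

text \<open>The number of literals to satisfy grows with the data, but the Helly property reduces
  their joint satisfaction to a condition on two instants, which first-order quantifiers
  express.\<close>

lemma seg_iff:
  assumes "p \<subseteq> cl" and xy: "x \<in> tem \<A>" "y \<in> tem \<A>"
  defines "R \<equiv> stay (p \<inter> (rising \<union> falling))"
  shows "seg p q \<A> l x y \<longleftrightarrow>
    (x \<le> y \<and> (p, q) \<in> R ^^ nat (y - x)) \<and>
    (\<forall>i\<in>tem \<A>. \<forall>j\<in>tem \<A>. compatible R p q \<A> l x y i j)" (is "_ \<longleftrightarrow> ?X \<and> ?Y")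
proof
  assume "seg p q \<A> l x y"
  then obtain s where s: "x \<le> y" "s x = p" "s y = q" "path R x y s" "obeys \<A> l x y s"
    unfolding seg_def R_def by blast
  have "path trans_rel x y s"
    using s(4) unfolding R_def by (rule path_mono[OF _ stay_subset_trans])
  then have sub: "s n \<subseteq> cl" if "x \<le> n" "n \<le> y" for n
    using path_trans_subset_cl[of x y s n] that s(2) assms(1) by simp
  have ?X
    by (intro conjI s(1) iffD2[OF path_relpow_iff[OF s(1)]] exI[of _ s] s(2-4))
  moreover have ?Y
    unfolding compatible_def
  proof (intro ballI impI, elim conjE)
    fix i j e e'
    assume ij: "x \<le> i" "i \<le> j" "j \<le> y" and "e \<in> lits" "e' \<in> lits" "active \<A> l e i" "active \<A> l e' j"
    then have "holds e (s i)" "holds e' (s j)"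
      using s(5) unfolding obeys_def by auto
    moreover have "(p, s i) \<in> R ^^ nat (i - x) \<and> (s i, s j) \<in> R ^^ nat (j - i) \<and> (s j, q) \<in> R ^^ nat (y - j)"
      by (intro iffD1[OF path_through_two_iff[OF ij]] exI[of _ s] conjI refl s(2-4))
    ultimately show "\<exists>u\<in>{u \<in> Pow cl. holds e u}. \<exists>v\<in>{v \<in> Pow cl. holds e' v}.
          (x \<le> i \<and> (p, u) \<in> R ^^ nat (i - x)) \<and> (i \<le> j \<and> (u, v) \<in> R ^^ nat (j - i)) \<and>
          (j \<le> y \<and> (v, q) \<in> R ^^ nat (y - j))"
      using ij sub by (intro bexI[of _ "s i"] bexI[of _ "s j"]) auto
  qed
  ultimately show "?X \<and> ?Y" ..
next
  assume *: "?X \<and> ?Y"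
  define I where "I = {(i, e) \<in> {x..y} \<times> lits. active \<A> l e i}"
  have pair: "\<exists>s. s x = p \<and> s y = q \<and> path R x y s \<and> holds e (s i) \<and> holds e' (s j)"
    if "(i, e) \<in> I" "(j, e') \<in> I" "i \<le> j" for i j e e'
  proof -
    have ij: "x \<le> i" "i \<le> j" "j \<le> y" "i \<in> tem \<A>" "j \<in> tem \<A>"
      and e: "e \<in> lits" "e' \<in> lits" "active \<A> l e i \<and> active \<A> l e' j"
      using that tem_interval[OF xy] by (auto simp: I_def)
    obtain u v where uv: "holds e u" "holds e' v" "(p, u) \<in> R ^^ nat (i - x)"
      "(u, v) \<in> R ^^ nat (j - i)" "(v, q) \<in> R ^^ nat (y - j)"
      using conjunct2[OF *, unfolded compatible_def, rule_format, OF ij(4,5) _ e] ij(1-3) by blast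
    then show ?thesis
      using path_through_two_iff[OF ij(1-3), where p = p and u = u and v = v and q = q and R = R] by auto
  qed
  have "\<exists>s. s x = p \<and> s y = q \<and> path R x y s \<and> (\<forall>(i, e)\<in>I. holds e (s i))"
  proof (rule maj_closed_path_helly)
    show "maj_closed R" unfolding R_def by (rule maj_closed_stay)
    show "finite I" unfolding I_def by (rule finite_subset[of _ "{x..y} \<times> lits"]) (auto simp: finite_lits)
    show "\<exists>s. s x = p \<and> s y = q \<and> path R x y s" using * path_relpow_iff[of x y p q R] by blast
    show "\<exists>s. s x = p \<and> s y = q \<and> path R x y s \<and> holds e (s i) \<and> holds e' (s j)"
      if "(i, e) \<in> I" "(j, e') \<in> I" for i e j e'
      using pair[OF that] pair[OF that(2,1)] by (cases "i \<le> j") (simp, meson linear)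
  qed
  then show "seg p q \<A> l x y"
    using * unfolding seg_def obeys_def I_def R_def by auto
qed

lemma definable_active:
  assumes "t \<in> X" "x \<in> X"
  shows "definable X (\<lambda>\<A> \<sigma>. active \<A> (\<sigma> t) e (\<sigma> x))"
proof (cases e)
  case (Pair \<chi> b)
  consider "\<not> b" | B where "b" "\<chi> = Atom B" | "b" "\<forall>B. \<chi> \<noteq> Atom B" by blast
  then show ?thesis
    using assms Pair by cases (simp_all add: definable_eq definable_pred definable_const)
qed

lemma definable_compatible:
  assumes "finite X" "t \<in> X" "x \<in> X" "y \<in> X" "i \<in> X" "j \<in> X" "finite R"
  shows "definable X (\<lambda>\<A> \<sigma>. compatible R p q \<A> (\<sigma> t) (\<sigma> x) (\<sigma> y) (\<sigma> i) (\<sigma> j))"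
  unfolding compatible_def using assms
  by (intro definable_imp definable_ball_finite definable_bex_finite finite_lits definable_conj
      definable_le definable_active definable_relpow) (simp_all add: finite_cl)

lemma definable_seg:
  assumes p: "p \<subseteq> cl" and X: "finite X" "t \<in> X" "x \<in> X" "y \<in> X"
  shows "definable X (\<lambda>\<A> \<sigma>. seg p q \<A> (\<sigma> t) (\<sigma> x) (\<sigma> y))"
proof (rule definable_cong)
  define R where "R = stay (p \<inter> (rising \<union> falling))"
  have "finite R" by (simp add: R_def finite_stay)
  then show "definable X (\<lambda>\<A> \<sigma>. (\<sigma> x \<le> \<sigma> y \<and> (p, q) \<in> R ^^ nat (\<sigma> y - \<sigma> x)) \<and>
    (\<forall>i\<in>tem \<A>. \<forall>j\<in>tem \<A>. compatible R p q \<A> (\<sigma> t) (\<sigma> x) (\<sigma> y) i j))"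
    using X
    by (intro definable_conj definable_relpow definable_all definable_compatible) auto
  show "((\<sigma> x \<le> \<sigma> y \<and> (p, q) \<in> R ^^ nat (\<sigma> y - \<sigma> x)) \<and>
    (\<forall>i\<in>tem \<A>. \<forall>j\<in>tem \<A>. compatible R p q \<A> (\<sigma> t) (\<sigma> x) (\<sigma> y) i j)) \<longleftrightarrow>
    seg p q \<A> (\<sigma> t) (\<sigma> x) (\<sigma> y)" if "range \<sigma> \<subseteq> tem \<A>" for \<A> \<sigma>
    unfolding R_def using that by (intro seg_iff[OF p, symmetric]) auto
qed

lemma definable_reach:
  assumes "p \<subseteq> cl" "finite X" "t \<in> X" "x \<in> X" "y \<in> X"
  shows "definable X (\<lambda>\<A> \<sigma>. reach k p q \<A> (\<sigma> t) (\<sigma> x) (\<sigma> y))"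
  using assms
proof (induction k arbitrary: p X x)
  case 0
  then show ?case by (simp add: definable_seg)
next
  case (Suc k)
  have add1: "definable Y (\<lambda>\<A> \<sigma>. \<sigma> w = \<sigma> z + 1)" if "finite Y" "z \<in> Y" "w \<in> Y" for Y z w
    using definable_add[OF that, of 1] by simp
  have "definable X (\<lambda>\<A> \<sigma>. \<exists>z\<in>tem \<A>. \<exists>w\<in>tem \<A>. \<exists>e\<in>trans_rel.
      w = z + 1 \<and> seg p (fst e) \<A> (\<sigma> t) (\<sigma> x) z \<and> reach k (snd e) q \<A> (\<sigma> t) w (\<sigma> y))"
    using Suc.prems
    by (intro definable_ex definable_bex_finite finite_trans definable_conj add1 definable_seg Suc.IH)
      (auto simp: trans_rel_def)
  then show ?case
    using Suc.prems by (simp add: case_prod_beta definable_disj definable_seg)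
qed

section \<open>Cutting runs at their change points\<close>

lemma reach_imp_path:
  assumes "reach k p q \<A> l x y"
  shows "x \<le> y \<and> (\<exists>s. s x = p \<and> s y = q \<and> path trans_rel x y s \<and> obeys \<A> l x y s)"
  using assms
proof (induction k arbitrary: p x)
  case 0
  then show ?case
    using path_mono[OF _ stay_subset_trans] by (auto simp: seg_def)
next
  case (Suc k)
  show ?case
  proof (cases "seg p q \<A> l x y")
    case True
    then show ?thesis
      using path_mono[OF _ stay_subset_trans] by (auto simp: seg_def)
  next
    case False
    then obtain z u v where z: "(u, v) \<in> trans_rel" "seg p u \<A> l x z" "reach k v q \<A> l (z + 1) y"
      using Suc.prems by auto
    obtain s where s: "x \<le> z" "s x = p" "s z = u" "path trans_rel x z s" "obeys \<A> l x z s"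
      using z(2) path_mono[OF _ stay_subset_trans] unfolding seg_def by blast
    obtain s' where s': "z + 1 \<le> y" "s' (z + 1) = v" "s' y = q" "path trans_rel (z + 1) y s'"
      "obeys \<A> l (z + 1) y s'"
      using Suc.IH[OF z(3)] by blast
    let ?s = "\<lambda>n. if n \<le> z then s n else s' n"
    have "path trans_rel x y ?s"
      by (rule path_join[OF s(4) s'(4)]) (use s s' z in simp)
    moreover have "obeys \<A> l x y ?s"
      using s(5) s'(5) by (auto simp: obeys_def)
    moreover have "?s x = p" "?s y = q" using s s' by auto
    ultimately show ?thesis using s(1) s'(1) by (intro conjI exI[of _ ?s]) auto
  qed
qed

lemma rank_path_mono:
  assumes "path trans_rel x y s" "x \<le> i" "i \<le> j" "j \<le> y"
  shows "rank (s i) \<le> rank (s j)"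
  using assms(3,4)
proof (induction j rule: int_ge_induct)
  case (step j)
  then have "(s j, s (j + 1)) \<in> trans_rel" using assms(1,2) by (auto simp: path_def)
  then have "rank (s j) \<le> rank (s (j + 1))" by (rule rank_mono)
  moreover have "rank (s i) \<le> rank (s j)" using step by simp
  ultimately show ?case by (rule order.trans[rotated])
qed simp

text \<open>The rank is squeezed between equal end values, hence constant, so no step changes a
  monotone formula.\<close>

lemma path_stay:
  assumes "path trans_rel x y s" "x \<le> y" "rank (s x) = rank (s y)"
  shows "path (stay (s x \<inter> (rising \<union> falling))) x y s"
proof -
  let ?b = "\<lambda>n. s n \<inter> (rising \<union> falling)"
  have eq: "rank (s n) = rank (s x)" if "x \<le> n" "n \<le> y" for n
    using rank_path_mono[OF assms(1), of x n] rank_path_mono[OF assms(1), of n y] that assms(2,3) by simp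
  have same: "n \<le> y \<longrightarrow> ?b n = ?b x" if "x \<le> n" for n
    using that
  proof (induction n rule: int_ge_induct)
    case (step n)
    show ?case
    proof
      assume n: "n + 1 \<le> y"
      then have "(s n, s (n + 1)) \<in> trans_rel" using assms(1) step by (auto simp: path_def)
      then have "?b n = ?b (n + 1)" using eq[of n] eq[of "n + 1"] n step(1) rank_eq_stay by simp
      then show "?b (n + 1) = ?b x" using step n by simp
    qed
  qed simp
  show ?thesis
    unfolding path_def
  proof (intro allI impI)
    fix n assume n: "x \<le> n \<and> n < y"
    then have "(s n, s (n + 1)) \<in> trans_rel" using assms(1) by (simp add: path_def)
    then show "(s n, s (n + 1)) \<in> stay (?b x)"
      using same[of n] same[of "n + 1"] n by (simp add: stay_def)
  qed
qed

text \<open>Here \<open>k\<close> is at least the number of rank increases still possible. With none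
  left the whole run is frozen; otherwise each cut raises the rank and uses up one unit of
  \<open>k\<close>.\<close>

lemma path_imp_reach:
  assumes "path trans_rel x y s" "obeys \<A> l x y s" "x \<le> y" "x \<in> tem \<A>" "y \<in> tem \<A>"
    and "card rising + card falling \<le> rank (s x) + k"
  shows "reach k (s x) (s y) \<A> l x y"
  using assms
proof (induction k arbitrary: x)
  case 0
  have "rank (s x) = rank (s y)"
    using rank_path_mono[OF 0(1), of x y] 0 rank_le[of "s y"] by simp
  then show ?case using 0 path_stay by (auto simp: seg_def)
next
  case (Suc k)
  \<comment> \<open>The cut is placed after the last instant that still has the initial
    rank.\<close>
  define Z where "Z = {n \<in> {x..y}. rank (s n) = rank (s x)}"
  define z where "z = Max Z"
  have "finite Z" unfolding Z_def by (rule finite_subset[of _ "{x..y}"]) auto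
  then have Z: "finite Z" "x \<in> Z" using Suc.prems(3) by (auto simp: Z_def)
  have "z \<in> Z" unfolding z_def by (rule Max_in) (use Z in auto)
  then have z: "x \<le> z" "z \<le> y" "rank (s z) = rank (s x)" by (auto simp: Z_def)
  have "path trans_rel x z s" using Suc.prems(1) z by (auto intro: path_subpath)
  then have "path (stay (s x \<inter> (rising \<union> falling))) x z s"
    using z by (intro path_stay) simp_all
  moreover have "obeys \<A> l x z s" using Suc.prems(2) z(2) by (simp add: obeys_def)
  ultimately have seg: "seg (s x) (s z) \<A> l x z"
    using z(1) unfolding seg_def by blast
  show ?case
  proof (cases "z = y")
    case True
    then show ?thesis using seg by simp
  next
    case False
    then have tr: "(s z, s (z + 1)) \<in> trans_rel" using Suc.prems(1) z by (auto simp: path_def)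
    have "z + 1 \<notin> Z" using Max_ge[OF Z(1), of "z + 1"] by (auto simp: z_def)
    then have "rank (s (z + 1)) \<noteq> rank (s x)" using z False by (auto simp: Z_def)
    then have "rank (s x) < rank (s (z + 1))" using rank_mono[OF tr] z(3) by simp
    moreover have zt: "z \<in> tem \<A>" "z + 1 \<in> tem \<A>"
      using tem_interval[OF Suc.prems(4,5)] z False by auto
    moreover have "path trans_rel (z + 1) y s" "obeys \<A> l (z + 1) y s"
      using Suc.prems(1,2) z by (auto simp: obeys_def intro: path_subpath)
    ultimately have "reach k (s (z + 1)) (s y) \<A> l (z + 1) y"
      using Suc.prems z False by (intro Suc.IH) auto
    then show ?thesis using seg tr zt by auto
  qed
qed

section \<open>Countermodels and the rewriting formula\<close>

text \<open>Types that some model of the ontology realises. Instant 0 represents all instants,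
  because models can be shifted.\<close>

definition ends :: "ltl set set" where
  "ends = {tp M 0 | M. ontology_model M \<O>}"

lemma tp_in_ends: "ontology_model M \<O> \<Longrightarrow> tp M n \<in> ends"
  unfolding ends_def using ontology_model_shift[of M n] tp_shift[of n M 0] by force

lemma finite_ends: "finite ends"
  by (rule finite_subset[of _ "Pow cl"]) (auto simp: ends_def tp_def finite_cl)

text \<open>A countermodel yields its own types. Conversely, the run found on the data is extended
  by the past of one model and the future of another, and a model is read off from the combined
  run.\<close>

lemma countermodel_iff:
  assumes \<A>: "data_instance \<A>" and l: "l \<in> tem \<A>"
  shows "(\<exists>M. kb_model M \<O> \<A> \<and> l \<notin> M A) \<longleftrightarrow>
    (\<exists>p\<in>ends. \<exists>q\<in>ends. reach (card rising + card falling) p q \<A> l 0 (max_time \<A>))"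
    (is "_ \<longleftrightarrow> (\<exists>p\<in>ends. \<exists>q\<in>ends. reach ?k p q \<A> l 0 ?m)")
proof
  assume "\<exists>M. kb_model M \<O> \<A> \<and> l \<notin> M A"
  then obtain M where M: "ontology_model M \<O>" "\<And>B n. (B, n) \<in> \<A> \<Longrightarrow> n \<in> M B" "l \<notin> M A"
    by (auto simp: kb_model_def)
  have "path trans_rel 0 ?m (tp M)" using trans_tp[OF M(1)] by (simp add: path_def)
  moreover have "obeys \<A> l 0 ?m (tp M)"
    using M(2,3) by (auto simp: obeys_def lits_def tp_def)
  ultimately have "reach ?k (tp M 0) (tp M ?m) \<A> l 0 ?m"
    using tem_data_instance[OF \<A>] by (intro path_imp_reach) auto
  then show "\<exists>p\<in>ends. \<exists>q\<in>ends. reach ?k p q \<A> l 0 ?m"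
    using tp_in_ends[OF M(1)] by blast
next
  assume "\<exists>p\<in>ends. \<exists>q\<in>ends. reach ?k p q \<A> l 0 ?m"
  then obtain p q where "p \<in> ends" "q \<in> ends" and pq: "reach ?k p q \<A> l 0 ?m" by blast
  then obtain M1 M' where M1: "ontology_model M1 \<O>" "p = tp M1 0"
    and M': "ontology_model M' \<O>" "q = tp M' 0"
    unfolding ends_def by blast
  obtain s where s: "s 0 = tp M1 0" "s ?m = tp M' 0" "path trans_rel 0 ?m s" "obeys \<A> l 0 ?m s"
    using reach_imp_path[OF pq] M1(2) M'(2) by blast
  \<comment> \<open>The second model is moved so that its instant 0 falls on the last instant of the
    data.\<close>
  define M2 where "M2 = (\<lambda>B. {n. n + - ?m \<in> M' B})"
  have M2: "ontology_model M2 \<O>" unfolding M2_def by (rule ontology_model_shift[OF M'(1)])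
  have s2: "s ?m = tp M2 ?m" unfolding M2_def tp_shift using s(2) by simp
  define r where "r n = (if n \<le> 0 then tp M1 n else if n \<le> ?m then s n else tp M2 n)" for n
  have m: "0 < ?m" "tem \<A> = {0..?m}" using tem_data_instance[OF \<A>] by auto
  have rs: "r n = s n" if "0 \<le> n" "n \<le> ?m" for n
    using that s(1) by (cases "n = 0") (auto simp: r_def)
  have right: "r n = tp M2 n" if "n \<ge> ?m" for n
    using that m s2 by (cases "n = ?m") (auto simp: r_def)
  have run: "(r n, r (n + 1)) \<in> trans_rel" for n
  proof -
    consider "n < 0" | "0 \<le> n" "n < ?m" | "n \<ge> ?m" by linarith
    then show ?thesis
    proof cases
      case 1
      then show ?thesis using trans_tp[OF M1(1), of n] by (simp add: r_def)
    next
      case 2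
      then show ?thesis using s(3) rs[of n] rs[of "n + 1"] by (simp add: path_def)
    next
      case 3
      then show ?thesis using trans_tp[OF M2, of n] right by simp
    qed
  qed
  \<comment> \<open>Concepts outside the closure are made true everywhere: this meets their data
    atoms, and no generator mentions them.\<close>
  define M where "M = (\<lambda>B. {n. Atom B \<in> cl \<longrightarrow> Atom B \<in> r n})"
  have tp: "tp M = r"
    unfolding M_def by (rule run_is_tp[OF run _ right]) (simp_all add: r_def)
  have "ontology_model M \<O>"
    unfolding ontology_model_def
  proof (intro ballI UNIV_eq_I[symmetric])
    fix \<alpha> n assume \<alpha>: "\<alpha> \<in> \<O>"
    \<comment> \<open>The interpretation hidden in \<open>good\<close> agrees with \<open>M\<close>
      on the generators of \<open>\<alpha>\<close>, so the truth of \<open>\<alpha>\<close> is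
      transferred to instant \<open>n\<close>.\<close>
    have "good (r n)" using run[of n] by (simp add: trans_rel_def)
    then obtain M0 n0 where M0: "n0 \<in> ltl_sem M0 \<alpha>"
      "\<And>\<chi>. \<chi> \<in> gens \<alpha> \<Longrightarrow> \<chi> \<in> r n \<longleftrightarrow> n0 \<in> ltl_sem M0 \<chi>"
      using \<alpha> unfolding good_def by metis
    have "\<chi> \<in> r n \<longleftrightarrow> n \<in> ltl_sem M \<chi>" if "\<chi> \<in> gens \<alpha>" for \<chi>
      using that cl_gens[OF \<alpha>] unfolding tp[symmetric] tp_def by auto
    then show "n \<in> ltl_sem M \<alpha>"
      using bool_comb_sem_cong[of "gens \<alpha>" \<alpha> n M n0 M0] M0 gens[OF \<alpha>] by blast
  qed
  moreover have "n \<in> M B" if "(B, n) \<in> \<A>" for B n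
  proof -
    have "finite \<A>" using \<A> by (simp add: data_instance_def)
    moreover have "n \<in> snd ` \<A>" using that by force
    ultimately have "n \<in> tem \<A>" by (simp add: tem_def min_time_def max_time_def)
    then have n: "0 \<le> n" "n \<le> ?m" using m by auto
    show ?thesis
    proof (cases "Atom B \<in> cl")
      case True
      then have "holds (Atom B, True) (s n)"
        using n that by (intro obeysD[OF s(4)]) (simp_all add: lits_def)
      then show ?thesis using rs[OF n] by (simp add: M_def)
    qed (simp add: M_def)
  qed
  moreover have "l \<notin> M A"
  proof -
    have lm: "0 \<le> l" "l \<le> ?m" using l m by auto
    then have "holds (Atom A, False) (s l)"
      by (intro obeysD[OF s(4)]) (simp_all add: lits_def)
    then show ?thesis using cl_query rs[OF lm] by (simp add: M_def)
  qed
  ultimately show "\<exists>M. kb_model M \<O> \<A> \<and> l \<notin> M A"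
    by (auto simp: kb_model_def)
qed

lemma rewritable: "fo_lt_cong_rewritable (\<O>, A)"
proof -
  let ?k = "card rising + card falling"
  \<comment> \<open>Without constants, the two ends of the domain are described as its least and
    greatest elements.\<close>
  let ?P = "\<lambda>\<A> l. \<exists>x\<in>tem \<A>. \<exists>y\<in>tem \<A>. (\<forall>z\<in>tem \<A>. x \<le> z) \<and> (\<forall>z\<in>tem \<A>. z \<le> y) \<and>
    (\<exists>p\<in>ends. \<exists>q\<in>ends. reach ?k p q \<A> l x y)"
  have "definable {0} (\<lambda>\<A> \<sigma>. ?P \<A> (\<sigma> 0))"
    by (intro definable_ex definable_all definable_bex_finite finite_ends definable_conj definable_le
        definable_reach) (auto simp: ends_def tp_def)
  then have "definable {0} (\<lambda>\<A> \<sigma>. \<not> ?P \<A> (\<sigma> 0))"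
    by (rule definable_not)
  then obtain \<phi> where \<phi>: "fo_lt_cong \<phi>" "fo_free \<phi> \<subseteq> {0}"
    "\<And>\<A> \<sigma>. data_instance \<A> \<Longrightarrow> range \<sigma> \<subseteq> tem \<A> \<Longrightarrow> fo_sat \<A> \<sigma> \<phi> \<longleftrightarrow> \<not> ?P \<A> (\<sigma> 0)"
    unfolding definable_def by blast
  \<comment> \<open>The trivial conjunct makes the set of free variables exactly \<open>{0}\<close>
    instead of a subset of it.\<close>
  let ?Q = "FConj (FEq 0 0) \<phi>"
  have "l \<in> ans (\<O>, A) \<A> \<longleftrightarrow> l \<in> tem \<A> \<and> fo_sat \<A> (\<lambda>_. l) ?Q" if \<A>: "data_instance \<A>" for \<A> l
  proof (cases "l \<in> tem \<A>")
    case True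
    let ?m = "max_time \<A>"
    have m: "tem \<A> = {0..?m}" "0 < ?m" using tem_data_instance[OF \<A>] by auto
    have "?P \<A> l \<longleftrightarrow> (\<exists>p\<in>ends. \<exists>q\<in>ends. reach ?k p q \<A> l 0 ?m)"
    proof -
      have "(\<forall>z\<in>tem \<A>. x \<le> z) \<longleftrightarrow> x = 0" if "x \<in> tem \<A>" for x using that m by force
      moreover have "(\<forall>z\<in>tem \<A>. z \<le> y) \<longleftrightarrow> y = ?m" if "y \<in> tem \<A>" for y using that m by force
      moreover have "0 \<in> tem \<A>" "?m \<in> tem \<A>" using m by auto
      ultimately show ?thesis by metis
    qed
    then have "fo_sat \<A> (\<lambda>_. l) ?Q \<longleftrightarrow> \<not> (\<exists>M. kb_model M \<O> \<A> \<and> l \<notin> M A)"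
      using \<phi>(3)[OF \<A>, of "\<lambda>_. l"] True countermodel_iff[OF \<A> True] by simp
    then show ?thesis using True by (auto simp: ans_def)
  qed (simp add: ans_def)
  then show ?thesis
    unfolding fo_lt_cong_rewritable_def using \<phi>(1,2)
    by (intro exI[of _ ?Q] exI[of _ "0 :: nat"]) auto
qed

end

theorem theoremB:
  fixes \<O> :: "ltl set" and A :: concept
  assumes "krom_ontology \<O>"
  shows "fo_lt_cong_rewritable (\<O>, A)"
proof -
  have "\<forall>\<alpha>\<in>\<O>. \<exists>L. finite L \<and> card L \<le> 2 \<and> (\<forall>\<chi>\<in>L. prefixed_atom \<chi>) \<and> bool_comb L \<alpha>"
    using assms by (simp add: krom_ontology_def krom_formula_def)
  then obtain gens where "\<forall>\<alpha>\<in>\<O>. finite (gens \<alpha>) \<and> card (gens \<alpha>) \<le> 2 \<and>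
      (\<forall>\<chi>\<in>gens \<alpha>. prefixed_atom \<chi>) \<and> bool_comb (gens \<alpha>) \<alpha>"
    by metis
  then interpret krom_closure \<O> A gens
    using assms by unfold_locales (auto simp: krom_ontology_def)
  show ?thesis by (rule rewritable)
qed

end
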